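(* Let $X\in RC$ and let $X=\prod_{i=1}^\infty N(a^{(i)}_1,\dots,a^{(i)}_n)$ be the ASW factorization of $X$. Let $k\ge1$ be an integer, let $i$ be an integer, and let $I=\{i_1<i_2<\dots<i_k\}$ be a set of positive integers such that $i_t\le i+t$ for each $t\in\{1,\dots,k\}$. Put $I^k_i=\{i+1,\dots,i+k\}$, $J^k_h=\{h+1,\dots,h+k\}$, $\lambda^k_{I,h}=\lambda(I,J^k_h)$, $\mu^k_{i,h}=\lambda(I^k_i,J^k_h)$, and let $\nu$ be the skew shape $(i+k,i+k,\dots,i+k)/(i_k,i_{k-1}+1,\dots,i_1+k-1)$ (with $k$ rows). Then $$s_\nu(\mathbf{a}^{(1)},\mathbf{a}^{(2)},\dots,\mathbf{a}^{(k)})=\lim_{h\to\infty}\frac{s_{\lambda^k_{I,h}}(\mathbf{a})}{s_{\mu^k_{i,h}}(\mathbf{a})}=\lim_{h\to\infty}\frac{\Delta_{I,J^k_h}(X)}{\Delta_{I^k_i,J^k_h}(X)}.$$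
   Context: Fix $n\ge1$. All matrices are doubly infinite real matrices $X=(x_{i,j})_{i,j\in\mathbb{Z}}$ with $x_{i+n,j+n}=x_{i,j}$, upper triangular with $1$'s on the diagonal; $\Delta_{I,J}(X)$ is the minor with row set $I$ and column set $J$. The whirl $M(a_1,\dots,a_n)$ has $m_{i,i}=1$, $m_{i,i+1}=a_i$ (index modulo $n$), other entries $0$. The curl $N(a_1,\dots,a_n)$ has $1$'s on the diagonal, $(i,j)$ entry $a_ia_{i+1}\cdots a_{j-1}$ for $i<j$ (indices modulo $n$), and $0$ below the diagonal; it is the inverse of $M(-a_1,\dots,-a_n)$. Limits of matrices are entrywise and $\prod_{i=1}^\infty X^{(i)}=\lim_{m\to\infty}X^{(1)}\cdots X^{(m)}$. $RC$ is the set of matrices $\prod_{i=1}^\infty N(b^{(i)}_1,\dots,b^{(i)}_n)$ with all $b^{(i)}_j>0$ and $\sum_{i,j}b^{(i)}_j<\infty$. ASW factorization of $X\in RC$: set $X_1=X$ and, inductively for $m\ge1$, $a^{(m)}_j=\epsilon_j(X_m):=\lim_{l\to\infty}(X_m)_{j,l}/(X_m)_{j+1,l}$ and $X_{m+1}=M(-a^{(m)}_1,\dots,-a^{(m)}_n)X_m$, so $X_m=N(a^{(m)}_1,\dots,a^{(m)}_n)X_{m+1}$. The resulting expression $X=\prod_{i=1}^\infty N(a^{(i)}_1,\dots,a^{(i)}_n)$ is the ASW factorization. Write $\mathbf{a}^{(i)}=(a^{(i)}_1,\dots,a^{(i)}_n)$ and $\mathbf{a}=(\mathbf{a}^{(1)},\mathbf{a}^{(2)},\dots)$;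 lower indices of $a^{(i)}_j$ are read modulo $n$. For $I=\{i_1<\dots<i_k\}$, $J=\{j_1<\dots<j_k\}$ with $i_t\le j_t$ for all $t$, $\lambda(I,J)$ is the skew shape $(j_k,j_{k-1}+1,\dots,j_1+k-1)/(i_k,i_{k-1}+1,\dots,i_1+k-1)$: in row $r$ (rows numbered from top, $r=1,\dots,k$) its squares occupy the columns strictly greater than the $r$-th entry of the second sequence and at most the $r$-th entry of the first. A square $s$ in row $r$ and column $c$ has residue $r(s)=c-r$ modulo $n$. A semistandard tableau $T$ of a skew shape is a filling of its squares $s$ by positive integers $T(s)$, weakly increasing along rows and strictly increasing down columns. Its weight is $a^T=\prod_s a^{(T(s))}_{r(s)}$. For a skew shape $\lambda$, $s_\lambda(\mathbf{a})=\sum_T a^T$ over all semistandard tableaux $T$ of shape $\lambda$, and $s_\nu(\mathbf{a}^{(1)},\dots,\mathbf{a}^{(k)})=\sum_T a^T$ over semistandard tableaux of shape $\nu$ with entries in $\{1,\dots,k\}$. *)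

theory Defs
  imports "HOL-Analysis.Infinite_Sum" "HOL-Library.FuncSet" "Jordan_Normal_Form.Determinant"
begin

type_synonym zmat = "int \<Rightarrow> int \<Rightarrow> real"

definition zmat_one :: zmat where
  "zmat_one i j = (if i = j then 1 else 0)"

text \<open>Product of upper triangular matrices: the sum over all integers \<open>t\<close> only has
  nonzero terms for \<open>i \<le> t \<le> j\<close>.\<close>

definition zmat_mult :: "zmat \<Rightarrow> zmat \<Rightarrow> zmat"  (infixl "\<odot>" 70) where
  "(X \<odot> Y) i j = (\<Sum>t\<in>{i..j}. X i t * Y t j)"

text \<open>An \<open>n\<close>-tuple of parameters with indices modulo \<open>n\<close> is a function on the integers that is
  only ever evaluated at the representatives \<open>j mod n\<close> in \<open>{0..<n}\<close>;
  the representative of \<open>n\<close> is \<open>0\<close>.\<close>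

definition whirl :: "nat \<Rightarrow> (int \<Rightarrow> real) \<Rightarrow> zmat" where
  "whirl n a i j = (if j = i then 1 else if j = i + 1 then a (i mod int n) else 0)"

definition curl :: "nat \<Rightarrow> (int \<Rightarrow> real) \<Rightarrow> zmat" where
  "curl n a i j = (if i \<le> j then \<Prod>t\<in>{i..<j}. a (t mod int n) else 0)"

text \<open>Sequences of parameter tuples are indexed from \<open>1\<close>; the value at \<open>0\<close> is never used.\<close>

primrec curl_prod :: "nat \<Rightarrow> (nat \<Rightarrow> int \<Rightarrow> real) \<Rightarrow> nat \<Rightarrow> zmat" where
  "curl_prod n b 0 = zmat_one"
| "curl_prod n b (Suc m) = curl_prod n b m \<odot> curl n (b (Suc m))"

definition has_curl_prod :: "nat \<Rightarrow> (nat \<Rightarrow> int \<Rightarrow> real) \<Rightarrow> zmat \<Rightarrow> bool" where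
  "has_curl_prod n b X \<longleftrightarrow> (\<forall>i j. (\<lambda>m. curl_prod n b m i j) \<longlonglongrightarrow> X i j)"

definition RC :: "nat \<Rightarrow> zmat set" where
  "RC n = {X. \<exists>b :: nat \<Rightarrow> int \<Rightarrow> real.
      (\<forall>m\<ge>1. \<forall>j\<in>{0..<int n}. b m j > 0) \<and>
      (\<lambda>(m, j). b m j) summable_on ({1..} \<times> {0..<int n}) \<and>
      has_curl_prod n b X}"

definition epsilon :: "zmat \<Rightarrow> int \<Rightarrow> real" where
  "epsilon X j = lim (\<lambda>l::nat. X j (int l) / X (j + 1) (int l))"

text \<open>\<open>asw_mat n X m\<close> is the matrix \<open>X\<^sub>m\<^sub>+\<^sub>1\<close> of the ASW recursion, which starts with \<open>X\<^sub>1 = X\<close>;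
  \<open>asw_param n X m\<close> is the tuple of parameters extracted from \<open>X\<^sub>m\<close>, for \<open>m \<ge> 1\<close>.\<close>

primrec asw_mat :: "nat \<Rightarrow> zmat \<Rightarrow> nat \<Rightarrow> zmat" where
  "asw_mat n X 0 = X"
| "asw_mat n X (Suc m) = whirl n (\<lambda>j. - epsilon (asw_mat n X m) j) \<odot> asw_mat n X m"

definition asw_param :: "nat \<Rightarrow> zmat \<Rightarrow> nat \<Rightarrow> int \<Rightarrow> real" where
  "asw_param n X m = epsilon (asw_mat n X (m - 1))"

text \<open>The \<open>t\<close>-th smallest element of a finite set, for \<open>1 \<le> t \<le> card I\<close>.\<close>

definition nth_elem :: "int set \<Rightarrow> nat \<Rightarrow> int" where
  "nth_elem I t = sorted_list_of_set I ! (t - 1)"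

definition minor :: "zmat \<Rightarrow> int set \<Rightarrow> int set \<Rightarrow> real" where
  "minor X I J =
     det (mat (card I) (card I) (\<lambda>(p, q). X (nth_elem I (Suc p)) (nth_elem J (Suc q))))"

text \<open>Squares are pairs (row, column), rows being numbered from \<open>1\<close> at the top. The skew shape
  \<open>(p 1, \<dots>, p k) / (q 1, \<dots>, q k)\<close> is represented by its set of squares.\<close>

definition skew_shape :: "nat \<Rightarrow> (nat \<Rightarrow> int) \<Rightarrow> (nat \<Rightarrow> int) \<Rightarrow> (nat \<times> int) set" where
  "skew_shape k p q = {(r, c). r \<in> {1..k} \<and> q r < c \<and> c \<le> p r}"

text \<open>The sequence \<open>(i\<^sub>k, i\<^sub>k\<^sub>-\<^sub>1 + 1, \<dots>, i\<^sub>1 + k - 1)\<close> attached to \<open>I = {i\<^sub>1 < \<dots> < i\<^sub>k}\<close>.\<close>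

definition shape_seq :: "int set \<Rightarrow> nat \<Rightarrow> int" where
  "shape_seq I r = nth_elem I (card I + 1 - r) + int r - 1"

definition lambda_shape :: "int set \<Rightarrow> int set \<Rightarrow> (nat \<times> int) set" where
  "lambda_shape I J = skew_shape (card I) (shape_seq J) (shape_seq I)"

definition ssyt :: "(nat \<times> int) set \<Rightarrow> nat set \<Rightarrow> (nat \<times> int \<Rightarrow> nat) set" where
  "ssyt S A = {T \<in> S \<rightarrow>\<^sub>E A.
     (\<forall>r c c'. (r, c) \<in> S \<longrightarrow> (r, c') \<in> S \<longrightarrow> c \<le> c' \<longrightarrow> T (r, c) \<le> T (r, c')) \<and>
     (\<forall>r r' c. (r, c) \<in> S \<longrightarrow> (r', c) \<in> S \<longrightarrow> r < r' \<longrightarrow> T (r, c) < T (r', c))}"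

definition residue :: "nat \<Rightarrow> nat \<times> int \<Rightarrow> int" where
  "residue n s = (snd s - int (fst s)) mod int n"

definition tableau_weight ::
    "nat \<Rightarrow> (nat \<Rightarrow> int \<Rightarrow> real) \<Rightarrow> (nat \<times> int) set \<Rightarrow> (nat \<times> int \<Rightarrow> nat) \<Rightarrow> real" where
  "tableau_weight n a S T = (\<Prod>s\<in>S. a (T s) (residue n s))"

definition loop_schur :: "nat \<Rightarrow> (nat \<Rightarrow> int \<Rightarrow> real) \<Rightarrow> (nat \<times> int) set \<Rightarrow> real" where
  "loop_schur n a S = (\<Sum>\<^sub>\<infinity>T\<in>ssyt S {1..}. tableau_weight n a S T)"

definition loop_schur_upto :: "nat \<Rightarrow> nat \<Rightarrow> (nat \<Rightarrow> int \<Rightarrow> real) \<Rightarrow> (nat \<times> int) set \<Rightarrow> real" where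
  "loop_schur_upto n k a S = (\<Sum>T\<in>ssyt S {1..k}. tableau_weight n a S T)"

definition int_block :: "nat \<Rightarrow> int \<Rightarrow> int set" where
  "int_block k h = {h + 1..h + int k}"

end

theory Submission
  imports Defs
begin

text \<open>Write \<open>X = P\<^sub>m X\<^sub>m\<^sub>+\<^sub>1\<close>, where \<open>P\<^sub>m\<close> is the product of the first \<open>m\<close> ASW curls, and \<open>D(I, J)\<close> for the
  minors of \<open>X\<close>.

  \<^item> Minors of a product of curls are sums over tableaux (\<open>pminor_gprod_eq_tableau_sum\<close>, a
  Lindstroem--Gessel--Viennot theorem). Since the ASW factorization converges to \<open>X\<close>
  (\<open>curl_tails_asw\<close>), the two quotients of the theorem agree for large \<open>h\<close>; and \<open>s\<^sub>\<nu>\<close> in the first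
  \<open>k\<close> tuples is the minor of \<open>P\<^sub>k\<close> with rows \<open>I\<close> and columns \<open>{i+1, \<dots>, i+k}\<close>. What remains is to
  show that \<open>D(I, J\<^sub>h) / D({i+1, \<dots>, i+k}, J\<^sub>h)\<close> tends to that minor.

  \<^item> The limit is easy if the columns \<open>l\<^sub>1 < \<dots> < l\<^sub>k\<close> go to infinity one at a time, the last one
  first. As quotients of rows of \<open>X\<^sub>s\<^sub>+\<^sub>1\<close> tend to entries of the next curl, a far column of \<open>X\<close>,
  divided by one entry of \<open>X\<^sub>s\<^sub>+\<^sub>1\<close>, is in the limit a column of \<open>P\<^sub>s\<^sub>+\<^sub>1\<close>, modulo the columns that
  have been sent to infinity before (\<open>frame_det_limit\<close>).

  \<^item> The consecutive columns \<open>J\<^sub>h\<close> are compared with such columns by monotonicity: the quotient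
  \<open>D(I, J) / D({i+1, \<dots>, i+k}, J)\<close> decreases when \<open>J\<close> moves to the right
  (\<open>minor_ratio_antimono\<close>). This is Sylvester's determinant identity together with the positivity
  of the minors. So the quotient at \<open>J\<^sub>h\<close> is at least the iterated limit, and for large \<open>h\<close> at most
  its value at any fixed \<open>J\<close>; some of these values are close to the iterated limit.

  \<^item> For the convergence of the ASW factorization, \<open>M(-\<epsilon>(X)) X\<close> is again an infinite product of
  curls: the whirl \<open>M(-\<epsilon>(X))\<close> is moved to the right through one curl after the other. Under this
  operation the first \<open>k + 1\<close> old parameters never sum up to more than \<open>\<epsilon>(X)\<close> plus the first \<open>k\<close>
  new ones (\<open>sum_new_param_ge\<close>), so the ASW parameters exhaust the superdiagonal of \<open>X\<close>, and the
  matrices \<open>X\<^sub>m\<close> tend to the identity.\<close>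

section \<open>Determinants and their rows\<close>

text \<open>Determinants are taken of functions instead of matrices, so that a row is a function and
  \<open>h(s := v)\<close> replaces row \<open>s\<close>. The order \<open>k\<close> is a parameter, as most arguments below alter it.\<close>

definition vdet :: "nat \<Rightarrow> (nat \<Rightarrow> nat \<Rightarrow> real) \<Rightarrow> real" where
  "vdet k h = det (mat k k (\<lambda>(p, q). h p q))"

lemma vdet_cong:
  assumes "\<And>p q. p < k \<Longrightarrow> q < k \<Longrightarrow> h p q = h' p q"
  shows "vdet k h = vdet k h'"
proof -
  have "mat k k (\<lambda>(p, q). h p q) = mat k k (\<lambda>(p, q). h' p q)"
    using assms by (intro eq_matI) auto
  then show ?thesis by (simp add: vdet_def)
qed

lemma vdet_transpose: "vdet k (\<lambda>p q. h q p) = vdet k h"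
proof -
  have "mat k k (\<lambda>(p, q). h q p) = transpose_mat (mat k k (\<lambda>(p, q). h p q))"
    by (intro eq_matI) auto
  then show ?thesis
    using det_transpose[of "mat k k (\<lambda>(p, q). h p q)" k] by (simp add: vdet_def)
qed

lemma vdet_Leibniz:
  "vdet k h = (\<Sum>\<pi> | \<pi> permutes {0..<k}. signof \<pi> * (\<Prod>p = 0..<k. h p (\<pi> p)))"
proof -
  have "vdet k h = (\<Sum>\<pi> | \<pi> permutes {0..<k}.
      signof \<pi> * (\<Prod>p = 0..<k. mat k k (\<lambda>(p, q). h p q) $$ (p, \<pi> p)))"
    unfolding vdet_def by (rule det_def') simp
  also have "\<dots> = (\<Sum>\<pi> | \<pi> permutes {0..<k}. signof \<pi> * (\<Prod>p = 0..<k. h p (\<pi> p)))"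
  proof (intro sum.cong refl arg_cong2[where f = "(*)"] prod.cong)
    fix \<pi> p assume "\<pi> \<in> {\<pi>. \<pi> permutes {0..<k}}" "p \<in> {0..<k}"
    then have "\<pi> p < k" using permutes_in_image[of \<pi> "{0..<k}" p] by auto
    then show "mat k k (\<lambda>(p, q). h p q) $$ (p, \<pi> p) = h p (\<pi> p)"
      using \<open>p \<in> {0..<k}\<close> by simp
  qed
  finally show ?thesis .
qed

lemma tendsto_vdet:
  assumes "\<And>p q. p < k \<Longrightarrow> q < k \<Longrightarrow> ((\<lambda>x. h x p q) \<longlongrightarrow> l p q) F"
  shows "((\<lambda>x. vdet k (h x)) \<longlongrightarrow> vdet k l) F"
  unfolding vdet_Leibniz
proof (intro tendsto_sum tendsto_mult tendsto_const tendsto_prod)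
  fix \<pi> p assume "\<pi> \<in> {\<pi>. \<pi> permutes {0..<k}}" "p \<in> {0..<k}"
  then have "\<pi> p < k" using permutes_in_image[of \<pi> "{0..<k}" p] by auto
  then show "((\<lambda>x. h x p (\<pi> p)) \<longlongrightarrow> l p (\<pi> p)) F"
    using \<open>p \<in> {0..<k}\<close> assms by simp
qed

text \<open>A block of zeros of size \<open>(k - t) \<times> (t + 1)\<close> is too large for a permutation to avoid it.\<close>

lemma vdet_zero_block:
  assumes t: "t < k" and zero: "\<And>p q. t \<le> p \<Longrightarrow> p < k \<Longrightarrow> q \<le> t \<Longrightarrow> h p q = 0"
  shows "vdet k h = 0"
  unfolding vdet_Leibniz
proof (intro sum.neutral ballI)
  fix \<pi> assume "\<pi> \<in> {\<pi>. \<pi> permutes {0..<k}}"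
  then have \<pi>: "\<pi> permutes {0..<k}" by simp
  have "\<exists>p\<in>{t..<k}. \<pi> p \<le> t"
  proof (rule ccontr)
    assume "\<not> ?thesis"
    moreover have "\<pi> p < k" if "p < k" for p
      using \<pi> permutes_in_image[of \<pi> "{0..<k}" p] that by auto
    ultimately have "\<pi> ` {t..<k} \<subseteq> {t<..<k}"
      by (auto simp: not_le)
    then have "card (\<pi> ` {t..<k}) \<le> card {t<..<k}" by (intro card_mono) auto
    moreover have "card (\<pi> ` {t..<k}) = card {t..<k}"
      using permutes_inj[OF \<pi>] by (intro card_image) (auto simp: inj_on_def inj_def)
    ultimately show False using t by simp
  qed
  then obtain p where "t \<le> p" "p < k" "\<pi> p \<le> t" by auto
  then have "(\<Prod>p = 0..<k. h p (\<pi> p)) = 0" using zero[of p "\<pi> p"] by (intro prod_zero) auto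
  then show "signof \<pi> * (\<Prod>p = 0..<k. h p (\<pi> p)) = 0" by simp
qed

lemma vdet_upper_unitriangular:
  assumes "\<And>p q. q < p \<Longrightarrow> p < k \<Longrightarrow> h p q = 0" and "\<And>p. p < k \<Longrightarrow> h p p = 1"
  shows "vdet k h = 1"
proof -
  let ?A = "mat k k (\<lambda>(p, q). h p q)"
  have "upper_triangular ?A" using assms(1) by auto
  then have "det ?A = prod_list (diag_mat ?A)" by (intro det_upper_triangular) auto
  also have "diag_mat ?A = map (\<lambda>p. 1) [0..<k]"
    unfolding diag_mat_def using assms(2) by (intro map_cong) auto
  finally show ?thesis by (simp add: vdet_def map_replicate_const)
qed

lemma vdet_equal_rows:
  assumes "s < k" "t < k" "s \<noteq> t" and "\<And>q. q < k \<Longrightarrow> h s q = h t q"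
  shows "vdet k h = 0"
  unfolding vdet_def
  by (rule det_identical_rows[where i = s and j = t]) (use assms in \<open>auto intro!: eq_vecI\<close>)

definition skip :: "nat \<Rightarrow> nat \<Rightarrow> nat" where
  "skip s p = (if p < s then p else Suc p)"

lemma vdet_Laplace:
  assumes "s < Suc k"
  shows "vdet (Suc k) h
    = (\<Sum>t<Suc k. h s t * ((-1) ^ (s + t) * vdet k (\<lambda>p q. h (skip s p) (skip t q))))"
proof -
  let ?A = "mat (Suc k) (Suc k) (\<lambda>(p, q). h p q)"
  have "vdet (Suc k) h = (\<Sum>t<Suc k. ?A $$ (s, t) * cofactor ?A s t)"
    unfolding vdet_def by (rule laplace_expansion_row) (use assms in auto)
  also have "\<dots> = (\<Sum>t<Suc k. h s t * ((-1) ^ (s + t) * vdet k (\<lambda>p q. h (skip s p) (skip t q))))"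
  proof (intro sum.cong refl)
    fix t assume t: "t \<in> {..<Suc k}"
    have "mat_delete ?A s t = mat k k (\<lambda>(p, q). h (skip s p) (skip t q))"
      unfolding mat_delete_def by (intro eq_matI) (auto simp: skip_def)
    then show "?A $$ (s, t) * cofactor ?A s t
        = h s t * ((-1) ^ (s + t) * vdet k (\<lambda>p q. h (skip s p) (skip t q)))"
      using assms t by (simp add: cofactor_def vdet_def)
  qed
  finally show ?thesis .
qed

text \<open>The entries of row \<open>s\<close> enter the determinant linearly, with coefficients (the cofactors) that
  depend on the other rows only.\<close>

lemma vdet_row_functional:
  assumes "s < k"
  obtains \<kappa> where "\<And>v. vdet k (h(s := v)) = (\<Sum>q<k. \<kappa> q * v q)"
proof -
  obtain m where k: "k = Suc m" using assms by (cases k) auto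
  have skip: "skip s p \<noteq> s" for p by (simp add: skip_def)
  have "vdet k (h(s := v))
      = (\<Sum>q<k. ((-1) ^ (s + q) * vdet m (\<lambda>p j. h (skip s p) (skip q j))) * v q)" for v
    unfolding k
    by (subst vdet_Laplace[of s]) (use assms k skip in \<open>auto intro!: sum.cong\<close>)
  then show thesis by (rule that)
qed

lemma vdet_zero_row:
  assumes "s < k" "\<And>q. q < k \<Longrightarrow> h s q = 0"
  shows "vdet k h = 0"
proof -
  obtain \<kappa> where \<kappa>: "\<And>v. vdet k (h(s := v)) = (\<Sum>q<k. \<kappa> q * v q)"
    using vdet_row_functional[OF assms(1)] by blast
  have "vdet k (h(s := h s)) = 0" unfolding \<kappa> using assms(2) by (intro sum.neutral) auto
  then show ?thesis by simp
qed

lemma vdet_row_add: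
  assumes "s < k"
  shows "vdet k (h(s := \<lambda>q. u q + x * v q)) = vdet k (h(s := u)) + x * vdet k (h(s := v))"
proof -
  obtain \<kappa> where "\<And>v. vdet k (h(s := v)) = (\<Sum>q<k. \<kappa> q * v q)"
    using vdet_row_functional[OF assms] by blast
  then show ?thesis by (simp add: algebra_simps sum.distrib sum_distrib_left)
qed

lemma vdet_row_add_other:
  assumes "s < k" "t < k" "s \<noteq> t"
  shows "vdet k (h(s := \<lambda>q. u q + x * h t q)) = vdet k (h(s := u))"
  using vdet_equal_rows[of s k t "h(s := h t)"] assms by (simp add: vdet_row_add)

lemma vdet_row_add_combination:
  assumes "s < k" "finite A" "\<phi> ` A \<subseteq> {..<k} - {s}"
  shows "vdet k (h(s := \<lambda>q. u q + (\<Sum>p\<in>A. x p * h (\<phi> p) q))) = vdet k (h(s := u))"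
  using assms(2,3)
proof (induction A arbitrary: u rule: finite_induct)
  case (insert a A)
  have "(\<lambda>q. u q + (\<Sum>p\<in>insert a A. x p * h (\<phi> p) q))
      = (\<lambda>q. (u q + x a * h (\<phi> a) q) + (\<Sum>p\<in>A. x p * h (\<phi> p) q))"
    using insert by (simp add: add.assoc)
  moreover have "vdet k (h(s := \<lambda>q. (u q + x a * h (\<phi> a) q) + (\<Sum>p\<in>A. x p * h (\<phi> p) q)))
      = vdet k (h(s := \<lambda>q. u q + x a * h (\<phi> a) q))"
    by (rule insert.IH) (use insert.prems in auto)
  ultimately have "vdet k (h(s := \<lambda>q. u q + (\<Sum>p\<in>insert a A. x p * h (\<phi> p) q)))
      = vdet k (h(s := \<lambda>q. u q + x a * h (\<phi> a) q))"
    by (simp only:)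
  also have "\<dots> = vdet k (h(s := u))"
    using insert.prems assms(1) by (intro vdet_row_add_other) auto
  finally show ?case .
qed simp

text \<open>The rows are altered from top to bottom, so that each of them sees the new value of its
  predecessor. Row \<open>0\<close> has none, whence \<open>x 0 = 0\<close>.\<close>

lemma vdet_bidiagonal:
  assumes new: "\<And>s q. s < k \<Longrightarrow> d s q = c s q + x s * d (s - 1) q" and x0: "x 0 = 0"
  shows "vdet k d = vdet k c"
proof -
  have "vdet k (\<lambda>s. if s < u then d s else c s) = vdet k c" if "u \<le> k" for u
    using that
  proof (induction u)
    case (Suc u)
    let ?e = "\<lambda>s. if s < u then d s else c s"
    have upd: "(\<lambda>s. if s < Suc u then d s else c s) = ?e(u := d u)"
      by (auto simp: fun_eq_iff)
    have "vdet k (?e(u := d u)) = vdet k (?e(u := c u))"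
    proof (cases u)
      case 0
      then have "d u = c u" using new[of 0] Suc.prems x0 by (auto simp: fun_eq_iff)
      then show ?thesis by simp
    next
      case (Suc w)
      have "d u = (\<lambda>q. c u q + x u * ?e w q)"
        using new[of u] Suc Suc.prems \<open>Suc u \<le> k\<close> by (auto simp: fun_eq_iff)
      then show ?thesis using vdet_row_add_other[of u k w ?e "c u" "x u"] Suc \<open>Suc u \<le> k\<close>
        by (simp del: fun_upd_apply)
    qed
    also have "?e(u := c u) = ?e" by (auto simp: fun_eq_iff)
    finally show ?case using Suc unfolding upd by (simp only: Suc_leD)
  qed simp
  from this[of k] have "vdet k (\<lambda>s. if s < k then d s else c s) = vdet k c" by simp
  then show ?thesis using vdet_cong[of k d "\<lambda>s. if s < k then d s else c s"] by simp
qed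

text \<open>The coefficients come from the adjugate matrix.\<close>

lemma vdet_rows_span:
  assumes "vdet m h \<noteq> 0"
  obtains c where "\<And>q. q < m \<Longrightarrow> u q = (\<Sum>p<m. c p * h p q)"
proof
  let ?A = "mat m m (\<lambda>(p, q). h p q)"
  have adj: "adj_mat ?A * ?A = det ?A \<cdot>\<^sub>m 1\<^sub>m m" and car: "adj_mat ?A \<in> carrier_mat m m"
    using adj_mat[of ?A m] by auto
  have prod: "(\<Sum>p<m. adj_mat ?A $$ (j, p) * h p q) = (if j = q then vdet m h else 0)"
    if "j < m" "q < m" for j q
  proof -
    have "(adj_mat ?A * ?A) $$ (j, q) = (\<Sum>p<m. adj_mat ?A $$ (j, p) * h p q)"
      using that car by (auto simp: scalar_prod_def atLeast0LessThan intro!: sum.cong)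
    then show ?thesis using that by (cases "j = q") (simp_all add: adj vdet_def)
  qed
  fix q assume q: "q < m"
  have "(\<Sum>p<m. ((\<Sum>j<m. u j * adj_mat ?A $$ (j, p)) / vdet m h) * h p q)
      = (\<Sum>p<m. \<Sum>j<m. u j * (adj_mat ?A $$ (j, p) * h p q)) / vdet m h"
    by (simp add: sum_divide_distrib sum_distrib_right mult.assoc)
  also have "(\<Sum>p<m. \<Sum>j<m. u j * (adj_mat ?A $$ (j, p) * h p q))
      = (\<Sum>j<m. u j * (\<Sum>p<m. adj_mat ?A $$ (j, p) * h p q))"
    by (subst sum.swap) (simp add: sum_distrib_left)
  also have "\<dots> = (\<Sum>j<m. u j * (if j = q then vdet m h else 0))"
    using q by (intro sum.cong refl) (simp add: prod)
  also have "\<dots> = u q * vdet m h" using q by (simp add: if_distrib cong: if_cong)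
  finally show "u q = (\<Sum>p<m. ((\<Sum>j<m. u j * adj_mat ?A $$ (j, p)) / vdet m h) * h p q)"
    using assms by simp
qed

section \<open>Sylvester's identity and quotients of minors\<close>

lemma vdet_single_entry_row:
  assumes "s < Suc k" "t < Suc k" and "\<And>q. q < Suc k \<Longrightarrow> q \<noteq> t \<Longrightarrow> h s q = 0"
  shows "vdet (Suc k) h = (-1) ^ (s + t) * h s t * vdet k (\<lambda>p q. h (skip s p) (skip t q))"
proof -
  have "vdet (Suc k) h
      = (\<Sum>j<Suc k. h s j * ((-1) ^ (s + j) * vdet k (\<lambda>p q. h (skip s p) (skip j q))))"
    by (rule vdet_Laplace[OF assms(1)])
  also have "\<dots> = (\<Sum>j\<in>{t}. h s j * ((-1) ^ (s + j) * vdet k (\<lambda>p q. h (skip s p) (skip j q))))"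
    by (rule sum.mono_neutral_right) (use assms in auto)
  finally show ?thesis by simp
qed

lemma vdet_two_entry_row:
  assumes "s < Suc k" "t < k"
    and "\<And>q. q < Suc k \<Longrightarrow> q \<noteq> t \<Longrightarrow> q \<noteq> Suc t \<Longrightarrow> h s q = 0"
  shows "vdet (Suc k) h = (-1) ^ (s + t)
    * (h s t * vdet k (\<lambda>p q. h (skip s p) (skip t q))
       - h s (Suc t) * vdet k (\<lambda>p q. h (skip s p) (skip (Suc t) q)))"
proof -
  have "vdet (Suc k) h
      = (\<Sum>j<Suc k. h s j * ((-1) ^ (s + j) * vdet k (\<lambda>p q. h (skip s p) (skip j q))))"
    by (rule vdet_Laplace[OF assms(1)])
  also have "\<dots> = (\<Sum>j\<in>{t, Suc t}.
      h s j * ((-1) ^ (s + j) * vdet k (\<lambda>p q. h (skip s p) (skip j q))))"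
    by (rule sum.mono_neutral_right) (use assms in auto)
  finally show ?thesis by (simp add: algebra_simps)
qed

text \<open>The identity relates an \<open>(m+2) \<times> (m+2)\<close> matrix with its minors that arise by deleting one or
  both of two neighbouring rows and columns. Since the common core \<open>M\<close> is invertible, the two
  special rows can be reduced by the other rows until they vanish outside of the two special
  columns. Then all five remaining minors are \<open>M\<close> times an entry, or a \<open>2 \<times> 2\<close> determinant, of the
  reduced rows; all signs cancel because rows and columns are neighbours.\<close>

lemma vdet_Sylvester:
  assumes s: "s \<le> m" and t: "t \<le> m"
    and M: "vdet m (\<lambda>p q. B (skip s (skip s p)) (skip t (skip t q))) \<noteq> 0"
  shows "vdet (Suc (Suc m)) B * vdet m (\<lambda>p q. B (skip s (skip s p)) (skip t (skip t q)))
    = vdet (Suc m) (\<lambda>p q. B (skip (Suc s) p) (skip (Suc t) q))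
        * vdet (Suc m) (\<lambda>p q. B (skip s p) (skip t q))
      - vdet (Suc m) (\<lambda>p q. B (skip (Suc s) p) (skip t q))
        * vdet (Suc m) (\<lambda>p q. B (skip s p) (skip (Suc t) q))"
proof -
  let ?\<phi> = "\<lambda>p. skip s (skip s p)" and ?\<psi> = "\<lambda>q. skip t (skip t q)"
  let ?M = "vdet m (\<lambda>p q. B (?\<phi> p) (?\<psi> q))"
  have "\<exists>c. \<forall>q<m. B r (?\<psi> q) = (\<Sum>p<m. c p * B (?\<phi> p) (?\<psi> q))" for r
    using vdet_rows_span[OF M, of "\<lambda>q. B r (?\<psi> q)"] by metis
  then obtain c where c: "\<And>r q. q < m \<Longrightarrow> B r (?\<psi> q) = (\<Sum>p<m. c r p * B (?\<phi> p) (?\<psi> q))"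
    by metis
  \<comment> \<open>Row \<open>r\<close>, reduced by the rows of the core.\<close>
  define y where "y r q = B r q + (\<Sum>p<m. - c r p * B (?\<phi> p) q)" for r q
  have y0: "y r q = 0" if "q < Suc (Suc m)" "q \<noteq> t" "q \<noteq> Suc t" for r q
  proof -
    define j where "j = (if q < t then q else q - 2)"
    have "q = ?\<psi> j" "j < m" using that t by (auto simp: j_def skip_def)
    then show ?thesis using c[of j r] by (simp add: y_def sum_negf)
  qed
  have skips: "skip (Suc s) (skip s p) = ?\<phi> p" "skip (Suc t) (skip t p) = ?\<psi> p" for p
    by (auto simp: skip_def)
  have minor: "vdet (Suc m) (\<lambda>p q. B (skip d p) (skip e q)) = (-1) ^ (s + t) * y (skip d s) (skip e t) * ?M"
    if d: "d = s \<or> d = Suc s" and e: "e = t \<or> e = Suc t" for d e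
  proof -
    let ?h = "\<lambda>p q. B (skip d p) (skip e q)"
    have sk: "skip d (skip s p) = ?\<phi> p" "skip e (skip t p) = ?\<psi> p" for p
      using d e skips by auto
    have upd: "?h(s := \<lambda>q. y (skip d s) (skip e q))
        = ?h(s := \<lambda>q. B (skip d s) (skip e q) + (\<Sum>p<m. - c (skip d s) p * ?h (skip s p) q))"
      by (simp only: y_def sk)
    have "vdet (Suc m) ?h = vdet (Suc m) (?h(s := \<lambda>q. B (skip d s) (skip e q)))"
      by (rule vdet_cong) auto
    also have "\<dots> = vdet (Suc m) (?h(s := \<lambda>q. y (skip d s) (skip e q)))"
      unfolding upd
      by (rule vdet_row_add_combination[symmetric]) (use s in \<open>auto simp: skip_def\<close>)
    also have "\<dots> = (-1) ^ (s + t) * y (skip d s) (skip e t)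
        * vdet m (\<lambda>p q. (?h(s := \<lambda>q. y (skip d s) (skip e q))) (skip s p) (skip t q))"
    proof (subst vdet_single_entry_row[of s m t])
      show "(?h(s := \<lambda>q. y (skip d s) (skip e q))) s q = 0" if "q < Suc m" "q \<noteq> t" for q
        using y0[of "skip e q" "skip d s"] e that by (auto simp: skip_def)
    qed (use s t in auto)
    also have "vdet m (\<lambda>p q. (?h(s := \<lambda>q. y (skip d s) (skip e q))) (skip s p) (skip t q)) = ?M"
      by (rule vdet_cong) (use sk in \<open>auto simp: skip_def\<close>)
    finally show ?thesis .
  qed
  have "vdet (Suc (Suc m)) B = vdet (Suc (Suc m)) (B(s := B s))" by simp
  also have "\<dots> = vdet (Suc (Suc m)) (B(s := y s))"
    unfolding y_def
    by (rule vdet_row_add_combination[symmetric]) (use s in \<open>auto simp: skip_def\<close>)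
  also have "\<dots> = (-1) ^ (s + t)
    * (y s t * vdet (Suc m) (\<lambda>p q. B (skip s p) (skip t q))
       - y s (Suc t) * vdet (Suc m) (\<lambda>p q. B (skip s p) (skip (Suc t) q)))"
  proof (subst vdet_two_entry_row[of s "Suc m" t])
    have *: "(\<lambda>p q. (B(s := y s)) (skip s p) (skip e q)) = (\<lambda>p q. B (skip s p) (skip e q))" for e
      by (auto simp: fun_eq_iff skip_def)
    show "(- 1) ^ (s + t) *
      ((B(s := y s)) s t * vdet (Suc m) (\<lambda>p q. (B(s := y s)) (skip s p) (skip t q)) -
       (B(s := y s)) s (Suc t) * vdet (Suc m) (\<lambda>p q. (B(s := y s)) (skip s p) (skip (Suc t) q))) =
      (- 1) ^ (s + t) *
      (y s t * vdet (Suc m) (\<lambda>p q. B (skip s p) (skip t q)) -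
       y s (Suc t) * vdet (Suc m) (\<lambda>p q. B (skip s p) (skip (Suc t) q)))"
      by (simp only: * fun_upd_same)
  qed (use s t y0 in auto)
  finally have B: "vdet (Suc (Suc m)) B = (-1) ^ (s + t)
    * (y s t * vdet (Suc m) (\<lambda>p q. B (skip s p) (skip t q))
       - y s (Suc t) * vdet (Suc m) (\<lambda>p q. B (skip s p) (skip (Suc t) q)))" .
  have sgn: "(-1::real) ^ (s + t) * (-1) ^ (s + t) = 1"
    by (simp flip: power_mult_distrib)
  have sk: "skip s s = Suc s" "skip (Suc s) s = s" "skip t t = Suc t" "skip (Suc t) t = t"
    by (simp_all add: skip_def)
  have alg: "\<sigma> * (a * (\<sigma> * d * M) - b * (\<sigma> * c * M)) * M
      = \<sigma> * a * M * (\<sigma> * d * M) - \<sigma> * b * M * (\<sigma> * c * M)" for \<sigma> a b c d M :: real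
    by (simp add: algebra_simps)
  show ?thesis
    unfolding B by (simp only: minor sk simp_thms) (rule alg)
qed

definition pminor :: "nat \<Rightarrow> zmat \<Rightarrow> (nat \<Rightarrow> int) \<Rightarrow> (nat \<Rightarrow> int) \<Rightarrow> real" where
  "pminor k X f g = vdet k (\<lambda>p q. X (f p) (g q))"

lemma pminor_cong:
  assumes "\<And>p. p < k \<Longrightarrow> f p = f' p" "\<And>p. p < k \<Longrightarrow> g p = g' p"
  shows "pminor k X f g = pminor k X f' g'"
  unfolding pminor_def using assms by (intro vdet_cong) auto

text \<open>Total positivity of an upper triangular matrix: a minor with \<open>f p > g p\<close> for some \<open>p\<close> vanishes
  by triangularity, all others are required to be strictly positive. Strictness keeps the quotients
  of minors and the core in Sylvester's identity away from division by zero.\<close>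

definition triangular_tp :: "zmat \<Rightarrow> bool" where
  "triangular_tp X \<longleftrightarrow> (\<forall>k f g. strict_mono_on {..<k} f \<longrightarrow> strict_mono_on {..<k} g
     \<longrightarrow> (\<forall>p<k. f p \<le> g p) \<longrightarrow> pminor k X f g > 0)"

lemma triangular_tpD:
  assumes "triangular_tp X" "strict_mono_on {..<k} f" "strict_mono_on {..<k} g"
    "\<And>p. p < k \<Longrightarrow> f p \<le> g p"
  shows "pminor k X f g > 0"
  using assms by (auto simp: triangular_tp_def)

text \<open>Sylvester's identity is applied to an index sequence with the new value of one index inserted
  next to the old one. Deleting either of the two gives the sequence before or after the change.\<close>

definition insert_after :: "nat \<Rightarrow> int \<Rightarrow> (nat \<Rightarrow> int) \<Rightarrow> nat \<Rightarrow> int" where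
  "insert_after s x f p = (if p \<le> s then f p else if p = Suc s then x else f (p - 1))"

lemma insert_after_skip:
  "insert_after s x f (skip (Suc s) p) = f p"
  "insert_after s x f (skip s p) = (f(s := x)) p"
  "insert_after s x f (skip s (skip s p)) = f (skip s p)"
  by (auto simp: insert_after_def skip_def)

lemma strict_mono_insert_after:
  assumes "strict_mono_on {..<k} f" "s < k" "f s < x" "Suc s < k \<Longrightarrow> x < f (Suc s)"
  shows "strict_mono_on {..<Suc k} (insert_after s x f)"
proof (rule strict_mono_onI)
  have f: "f p < f q" if "p < q" "q < k" for p q
    using assms(1) that by (auto simp: strict_mono_on_def)
  then have f': "f p \<le> f q" if "p \<le> q" "q < k" for p q
    using that by (cases "p = q") (auto simp: less_imp_le)
  fix p q :: nat assume "p \<in> {..<Suc k}" "q \<in> {..<Suc k}" "p < q"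
  then show "insert_after s x f p < insert_after s x f q"
    using f[of p q] f[of p "q - 1"] f[of "p - 1" "q - 1"] f'[of p s] f'[of "Suc s" "q - 1"] assms(2-)
    unfolding insert_after_def by (cases q) (auto split: if_splits)
qed

lemma strict_mono_skip:
  assumes "strict_mono_on {..<Suc k} f"
  shows "strict_mono_on {..<k} (\<lambda>p. f (skip s p))"
  using assms by (auto simp: strict_mono_on_def skip_def)

lemma strict_mono_upd:
  fixes x :: int
  assumes "strict_mono_on {..<k} f" "f s < x" "Suc s < k \<Longrightarrow> x < f (Suc s)" "s < k"
  shows "strict_mono_on {..<k} (f(s := x))"
proof -
  have "strict_mono_on {..<k} (\<lambda>p. insert_after s x f (skip s p))"
    by (rule strict_mono_skip[OF strict_mono_insert_after]) (use assms in auto)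
  then show ?thesis by (simp add: insert_after_skip fun_upd_def)
qed

text \<open>The bound \<open>N\<close> separates the rows from the columns. Hence all minors in Sylvester's identity lie
  weakly above the diagonal, and \<open>triangular_tp\<close> applies to each of them.\<close>

lemma minor_ratio_step:
  assumes X: "triangular_tp X"
    and f: "strict_mono_on {..<k} f" "s < k" "f s < x" "Suc s < k \<Longrightarrow> x < f (Suc s)"
    and g: "strict_mono_on {..<k} g" "t < k" "g t < y" "Suc t < k \<Longrightarrow> y < g (Suc t)"
    and N: "\<And>p. p < k \<Longrightarrow> f p \<le> N" "x \<le> N" "\<And>q. q < k \<Longrightarrow> N \<le> g q"
  shows "pminor k X f (g(t := y)) / pminor k X (f(s := x)) (g(t := y))
    \<le> pminor k X f g / pminor k X (f(s := x)) g"
proof -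
  obtain m where k: "k = Suc m" using f(2) by (cases k) auto
  let ?f = "insert_after s x f" and ?g = "insert_after t y g"
  let ?B = "\<lambda>p q. X (?f p) (?g q)"
  have "N \<le> y" using N(3)[OF g(2)] g(3) by simp
  have fN: "?f p \<le> N" if "p < Suc k" for p
    using that N f(2) by (auto simp: insert_after_def)
  have gN: "N \<le> ?g q" if "q < Suc k" for q
    using that N g(2) \<open>N \<le> y\<close> by (auto simp: insert_after_def)
  have "pminor (Suc k) X ?f ?g > 0"
    using X strict_mono_insert_after[OF f] strict_mono_insert_after[OF g]
    by (rule triangular_tpD) (use fN gN in \<open>blast intro: order_trans\<close>)+
  then have B: "vdet (Suc (Suc m)) ?B > 0" by (simp add: pminor_def k)
  have "pminor m X (\<lambda>p. f (skip s p)) (\<lambda>p. g (skip t p)) > 0"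
  proof (rule triangular_tpD[OF X])
    show "f (skip s p) \<le> g (skip t p)" if "p < m" for p
      using N(1)[of "skip s p"] N(3)[of "skip t p"] that k
      by (auto simp: skip_def split: if_splits)
  qed (use strict_mono_skip f(1) g(1) k in blast)+
  then have M: "vdet m (\<lambda>p q. ?B (skip s (skip s p)) (skip t (skip t q))) > 0"
    by (simp only: insert_after_skip(3) pminor_def)
  have "0 < vdet (Suc (Suc m)) ?B * vdet m (\<lambda>p q. ?B (skip s (skip s p)) (skip t (skip t q)))"
    using B M by simp
  also have "\<dots> = pminor k X f g * pminor k X (f(s := x)) (g(t := y))
      - pminor k X f (g(t := y)) * pminor k X (f(s := x)) g"
    by (subst vdet_Sylvester) (use f(2) g(2) k M in \<open>simp_all add: insert_after_skip pminor_def\<close>)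
  finally have main: "pminor k X f (g(t := y)) * pminor k X (f(s := x)) g
      < pminor k X f g * pminor k X (f(s := x)) (g(t := y))" by simp
  have pos: "pminor k X (f(s := x)) g' > 0"
    if "strict_mono_on {..<k} g'" "\<And>q. q < k \<Longrightarrow> N \<le> g' q" for g'
  proof (rule triangular_tpD[OF X strict_mono_upd that(1)])
    show "(f(s := x)) p \<le> g' p" if "p < k" for p
      using N(1)[OF that] N(2) \<open>p < k \<Longrightarrow> N \<le> g' p\<close> that by auto
  qed (use f in auto)
  have "pminor k X (f(s := x)) g > 0" "pminor k X (f(s := x)) (g(t := y)) > 0"
    using pos g(1) strict_mono_upd[OF g(1,3,4,2)] N(3) \<open>N \<le> y\<close> by auto
  then show ?thesis using main by (simp add: field_simps)
qed

text \<open>Interpolates between two index sequences, the largest index being changed first. Raising one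
  index at a time in this order keeps the sequence strictly increasing.\<close>

definition splice_at :: "nat \<Rightarrow> (nat \<Rightarrow> int) \<Rightarrow> (nat \<Rightarrow> int) \<Rightarrow> nat \<Rightarrow> int" where
  "splice_at t f f' p = (if p < t then f p else f' p)"

lemma strict_mono_splice_at:
  assumes "strict_mono_on {..<k} f" "strict_mono_on {..<k} f'" "\<And>p. p < k \<Longrightarrow> f p \<le> f' p"
  shows "strict_mono_on {..<k} (splice_at t f f')"
proof (rule strict_mono_onI)
  fix p q :: nat assume "p \<in> {..<k}" "q \<in> {..<k}" "p < q"
  then have "f p < f q" "f' p < f' q" "f q \<le> f' q" using assms by (auto simp: strict_mono_on_def)
  then show "splice_at t f f' p < splice_at t f f' q" using \<open>p < q\<close> by (auto simp: splice_at_def)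
qed

lemma splice_at_0: "splice_at 0 f f' = f'"
  by (simp add: splice_at_def fun_eq_iff)

lemma splice_at_step: "splice_at t f f' = (splice_at (Suc t) f f')(t := f' t)"
  by (auto simp: splice_at_def fun_eq_iff)

lemma minor_ratio_row_step:
  assumes X: "triangular_tp X"
    and f: "strict_mono_on {..<k} f" "s < k" "f s < x" "Suc s < k \<Longrightarrow> x < f (Suc s)"
    and g: "strict_mono_on {..<k} g" "strict_mono_on {..<k} g'" "\<And>q. q < k \<Longrightarrow> g q \<le> g' q"
    and N: "\<And>p. p < k \<Longrightarrow> f p \<le> N" "x \<le> N" "\<And>q. q < k \<Longrightarrow> N \<le> g q"
  shows "pminor k X f g' / pminor k X (f(s := x)) g' \<le> pminor k X f g / pminor k X (f(s := x)) g"
proof -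
  let ?R = "\<lambda>g. pminor k X f g / pminor k X (f(s := x)) g"
  have "?R (splice_at (k - d) g g') \<le> ?R g" if "d \<le> k" for d
    using that
  proof (induction d)
    case 0
    have "pminor k X f' (splice_at k g g') = pminor k X f' g" for f'
      by (rule pminor_cong) (auto simp: splice_at_def)
    then show ?case by simp
  next
    case (Suc d)
    define t where "t = k - Suc d"
    have t: "t < k" "k - d = Suc t" using Suc.prems by (auto simp: t_def)
    let ?h = "splice_at (Suc t) g g'"
    have "?R (?h(t := g' t)) \<le> ?R ?h"
    proof (cases "g t = g' t")
      case True
      then have "?h(t := g' t) = ?h" by (auto simp: splice_at_def fun_eq_iff)
      then show ?thesis by simp
    next
      case False
      show ?thesis
      proof (rule minor_ratio_step[OF X f _ t(1) _ _ N(1,2)])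
        show "strict_mono_on {..<k} ?h" by (rule strict_mono_splice_at[OF g])
        show "?h t < g' t" using False g(3)[OF t(1)] by (simp add: splice_at_def)
        show "g' t < ?h (Suc t)" if "Suc t < k"
          using g(2) that by (auto simp: splice_at_def strict_mono_on_def)
        show "N \<le> ?h q" if "q < k" for q
          using N(3)[OF that] g(3)[OF that] by (auto simp: splice_at_def)
      qed
    qed
    also have "\<dots> \<le> ?R g" using Suc t by (simp only: Suc_leD)
    finally show ?case by (simp only: splice_at_step[of t] flip: t_def)
  qed
  from this[of k] show ?thesis by (simp add: splice_at_0)
qed

text \<open>The quotient is a telescoping product of quotients in which a single row index changes, and each
  factor decreases.\<close>

lemma minor_ratio_antimono:
  assumes X: "triangular_tp X"
    and f: "strict_mono_on {..<k} f" "strict_mono_on {..<k} f'" "\<And>p. p < k \<Longrightarrow> f p \<le> f' p"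
    and g: "strict_mono_on {..<k} g" "strict_mono_on {..<k} g'" "\<And>q. q < k \<Longrightarrow> g q \<le> g' q"
    and N: "\<And>p. p < k \<Longrightarrow> f' p \<le> N" "\<And>q. q < k \<Longrightarrow> N \<le> g q"
  shows "pminor k X f g' / pminor k X f' g' \<le> pminor k X f g / pminor k X f' g"
proof -
  have N': "N \<le> g' q" if "q < k" for q using N(2)[OF that] g(3)[OF that] by simp
  let ?f = "\<lambda>s. splice_at s f f'"
  have fN: "?f s p \<le> N" if "p < k" for s p
    using N(1)[OF that] f(3)[OF that] by (auto simp: splice_at_def)
  have mono: "strict_mono_on {..<k} (?f s)" for s by (rule strict_mono_splice_at[OF f])
  have pos: "pminor k X (?f s) g > 0" "pminor k X (?f s) g' > 0" for s
    using triangular_tpD[OF X mono g(1)] triangular_tpD[OF X mono g(2)] fN N(2) N'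
    by (meson order_trans)+
  then have pos': "pminor k X f' g > 0" "pminor k X f' g' > 0" using pos[of 0] by (simp_all add: splice_at_0)
  have "pminor k X (?f s) g' / pminor k X f' g' \<le> pminor k X (?f s) g / pminor k X f' g"
    if "s \<le> k" for s
    using that
  proof (induction s)
    case 0
    show ?case using pos' by (simp add: splice_at_0)
  next
    case (Suc s)
    have "pminor k X (?f (Suc s)) g' / pminor k X (?f s) g'
        \<le> pminor k X (?f (Suc s)) g / pminor k X (?f s) g"
    proof (cases "f s = f' s")
      case True
      then have "?f (Suc s) = ?f s" by (auto simp: splice_at_def fun_eq_iff less_Suc_eq)
      then show ?thesis using pos[of s] by simp
    next
      case False
      show ?thesis unfolding splice_at_step[of s]
      proof (rule minor_ratio_row_step[OF X mono _ _ _ g _ _ N(2)])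
        show "?f (Suc s) s < f' s" using False f(3)[of s] Suc.prems by (simp add: splice_at_def)
        show "f' s < ?f (Suc s) (Suc s)" if "Suc s < k"
          using f(2) that by (auto simp: splice_at_def strict_mono_on_def)
      qed (use Suc.prems fN N(1) in auto)
    qed
    then have "(pminor k X (?f (Suc s)) g' / pminor k X (?f s) g')
          * (pminor k X (?f s) g' / pminor k X f' g')
        \<le> (pminor k X (?f (Suc s)) g / pminor k X (?f s) g)
          * (pminor k X (?f s) g / pminor k X f' g)"
      using Suc pos[of s] pos[of "Suc s"] pos' by (intro mult_mono) simp_all
    then show ?case using pos[of s] by simp
  qed
  from this[of k] show ?thesis
    using pminor_cong[of k "?f k" f] by (simp add: splice_at_def)
qed

section \<open>Minors of products of curls are tableau sums\<close>

text \<open>Curls with one parameter for every integer. Periodicity of the parameters matters only for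
  passing to the tuples modulo \<open>n\<close> at the very end.\<close>

definition gcurl :: "(int \<Rightarrow> real) \<Rightarrow> zmat" where
  "gcurl c i j = (if i \<le> j then \<Prod>t\<in>{i..<j}. c t else 0)"

primrec gprod :: "(nat \<Rightarrow> int \<Rightarrow> real) \<Rightarrow> nat \<Rightarrow> zmat" where
  "gprod b 0 = zmat_one"
| "gprod b (Suc m) = gprod b m \<odot> gcurl (b (Suc m))"

lemma gcurl_step: "i < j \<Longrightarrow> gcurl c i j = gcurl c i (j - 1) * c (j - 1)"
proof -
  assume "i < j"
  then have "{i..<j} = insert (j - 1) {i..<j - 1}" by auto
  then show ?thesis using \<open>i < j\<close> by (simp add: gcurl_def)
qed

lemma gprod_lower: "j < i \<Longrightarrow> gprod b m i j = 0"
  by (cases m) (simp_all add: zmat_one_def zmat_mult_def)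

lemma gprod_diag: "gprod b m i i = 1"
  by (induction m) (simp_all add: zmat_one_def zmat_mult_def gcurl_def)

text \<open>The column form of \<open>P\<^sub>m\<^sub>+\<^sub>1 M(-b) = P\<^sub>m\<close>. In terms of tableaux, the last square of
  a row either has a smaller entry or is removed.\<close>

lemma gprod_Suc:
  "gprod b (Suc m) i j = gprod b m i j + b (Suc m) (j - 1) * gprod b (Suc m) i (j - 1)"
proof (cases "i < j")
  case True
  have "{i..j} = insert j {i..j - 1}" using True by auto
  then have "gprod b (Suc m) i j = (\<Sum>t\<in>insert j {i..j - 1}. gprod b m i t * gcurl (b (Suc m)) t j)"
    by (simp only: gprod.simps zmat_mult_def)
  also have "\<dots> = gprod b m i j + (\<Sum>t\<in>{i..j - 1}. gprod b m i t * gcurl (b (Suc m)) t j)"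
    by (subst sum.insert) (auto simp: gcurl_def)
  also have "(\<Sum>t\<in>{i..j - 1}. gprod b m i t * gcurl (b (Suc m)) t j)
      = (\<Sum>t\<in>{i..j - 1}. b (Suc m) (j - 1) * (gprod b m i t * gcurl (b (Suc m)) t (j - 1)))"
    by (intro sum.cong) (auto simp: gcurl_step)
  finally show ?thesis by (simp add: zmat_mult_def sum_distrib_left)
next
  case False
  then show ?thesis
    using gprod_lower[of j i] gprod_lower[of "j - 1" i] gprod_diag
    by (cases "i = j") (auto simp del: gprod.simps)
qed

text \<open>The content \<open>c - r\<close> of a square is its residue before reduction modulo \<open>n\<close>.\<close>

definition content_weight :: "(nat \<Rightarrow> int \<Rightarrow> real) \<Rightarrow> (nat \<times> int) set \<Rightarrow> (nat \<times> int \<Rightarrow> nat) \<Rightarrow> real"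
  where "content_weight b S T = (\<Prod>s\<in>S. b (T s) (snd s - int (fst s)))"

text \<open>The skew shape \<open>\<lambda>(I, J)\<close> for sets that are listed increasingly by \<open>f\<close> and \<open>g\<close>, starting at index
  \<open>0\<close>. Position \<open>t\<close> of the sequences belongs to row \<open>k - t\<close> of the shape, so that the bottom row
  comes from the smallest indices.\<close>

definition det_shape :: "nat \<Rightarrow> (nat \<Rightarrow> int) \<Rightarrow> (nat \<Rightarrow> int) \<Rightarrow> (nat \<times> int) set" where
  "det_shape k f g
     = skew_shape k (\<lambda>r. g (k - r) + int r - 1) (\<lambda>r. f (k - r) + int r - 1)"

lemma mem_det_shape:
  "(r, c) \<in> det_shape k f g
     \<longleftrightarrow> 1 \<le> r \<and> r \<le> k \<and> f (k - r) + int r - 1 < c \<and> c \<le> g (k - r) + int r - 1"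
  by (auto simp: det_shape_def skew_shape_def)

lemma finite_det_shape: "finite (det_shape k f g)"
proof -
  have "det_shape k f g
      = (SIGMA r:{1..k}. {f (k - r) + int r - 1<..g (k - r) + int r - 1})"
    by (auto simp: mem_det_shape)
  then show ?thesis by simp
qed

lemma finite_ssyt: "finite S \<Longrightarrow> finite A \<Longrightarrow> finite (ssyt S A)"
  by (rule finite_subset[of _ "S \<rightarrow>\<^sub>E A"]) (auto simp: ssyt_def intro: finite_PiE)

lemma ssyt_restrict:
  assumes "T \<in> ssyt (insert s S) A"
  shows "restrict T S \<in> ssyt S A"
  using assms unfolding ssyt_def by (simp add: PiE_iff)

lemma ssyt_extend:
  assumes T: "T \<in> ssyt S A" and s: "s \<notin> S" and a: "a \<in> A"
    and row: "\<And>c. (fst s, c) \<in> S \<Longrightarrow> c \<le> snd s \<and> T (fst s, c) \<le> a"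
    and column: "\<And>r. (r, snd s) \<in> S \<Longrightarrow> r < fst s \<and> T (r, snd s) < a"
  shows "T(s := a) \<in> ssyt (insert s S) A"
proof -
  obtain r0 c0 where s0: "s = (r0, c0)" by (cases s)
  have T': "T \<in> S \<rightarrow>\<^sub>E A"
    "\<And>r c c'. (r, c) \<in> S \<Longrightarrow> (r, c') \<in> S \<Longrightarrow> c \<le> c' \<Longrightarrow> T (r, c) \<le> T (r, c')"
    "\<And>r r' c. (r, c) \<in> S \<Longrightarrow> (r', c) \<in> S \<Longrightarrow> r < r' \<Longrightarrow> T (r, c) < T (r', c)"
    using T by (auto simp: ssyt_def)
  have "T(s := a) \<in> insert s S \<rightarrow>\<^sub>E A" using T'(1) a by (auto simp: PiE_iff extensional_def)
  moreover have "(T(s := a)) (r, c) \<le> (T(s := a)) (r, c')"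
    if "(r, c) \<in> insert s S" "(r, c') \<in> insert s S" "c \<le> c'" for r c c'
  proof (cases "(r, c) \<in> S \<and> (r, c') \<in> S")
    case True
    then show ?thesis using T'(2) s that by auto
  next
    case False
    then have "r = r0" "c' = c0" "(r, c) = s \<or> (r, c) \<in> S" using that row[of c'] by (auto simp: s0)
    then show ?thesis using row[of c] by (auto simp: s0)
  qed
  moreover have "(T(s := a)) (r, c) < (T(s := a)) (r', c)"
    if "(r, c) \<in> insert s S" "(r', c) \<in> insert s S" "r < r'" for r r' c
  proof (cases "(r, c) \<in> S \<and> (r', c) \<in> S")
    case True
    then show ?thesis using T'(3) s that by auto
  next
    case False
    then have "c = c0" "r' = r0" "(r, c) \<in> S" using that column[of r'] by (auto simp: s0)
    then show ?thesis using column[of r] \<open>r < r'\<close> by (auto simp: s0)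
  qed
  ultimately show ?thesis unfolding ssyt_def by blast
qed

text \<open>A square \<open>s\<close> at the end of its row and of its column can be filled with the maximal entry \<open>m + 1\<close>
  exactly when all entries above it are at most \<open>m\<close>. The squares with an entry restricted to \<open>m\<close>
  are given by \<open>P\<close>.\<close>

lemma sum_ssyt_corner:
  assumes S: "finite S" and s: "s \<notin> S"
    and row: "\<And>c. (fst s, c) \<in> S \<Longrightarrow> c \<le> snd s"
    and column: "\<And>r. (r, snd s) \<in> S \<Longrightarrow> r < fst s" "\<And>r. (r, snd s) \<in> S \<Longrightarrow> P (r, snd s)"
  shows "(\<Sum>T | T \<in> ssyt (insert s S) {1..Suc m} \<and> T s = Suc m \<and> (\<forall>x\<in>S. P x \<longrightarrow> T x \<le> m).
        content_weight b (insert s S) T)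
    = b (Suc m) (snd s - int (fst s))
      * (\<Sum>T | T \<in> ssyt S {1..Suc m} \<and> (\<forall>x\<in>S. P x \<longrightarrow> T x \<le> m). content_weight b S T)"
    (is "(\<Sum>T\<in>?L. _) = _ * (\<Sum>T\<in>?F. _)")
  unfolding sum_distrib_left
proof (rule sum.reindex_bij_witness[where j = "\<lambda>T. restrict T S" and i = "\<lambda>T. T(s := Suc m)"])
  fix T assume "T \<in> ?L"
  then have T: "T \<in> ssyt (insert s S) {1..Suc m}" "T s = Suc m" "\<forall>x\<in>S. P x \<longrightarrow> T x \<le> m"
    by blast+
  have "T \<in> extensional (insert s S)" using T(1) by (simp add: ssyt_def PiE_iff)
  then show "(restrict T S)(s := Suc m) = T"
    using T(2) by (intro ext) (auto simp: extensional_def)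
  show "restrict T S \<in> ?F" using ssyt_restrict[OF T(1)] T(3) by simp
  have "content_weight b S (restrict T S) = content_weight b S T"
    unfolding content_weight_def by (intro prod.cong) simp_all
  moreover have "content_weight b (insert s S) T = b (T s) (snd s - int (fst s)) * content_weight b S T"
    unfolding content_weight_def by (rule prod.insert[OF S s])
  ultimately show "b (Suc m) (snd s - int (fst s)) * content_weight b S (restrict T S)
      = content_weight b (insert s S) T"
    using T(2) by simp
next
  fix T assume "T \<in> ?F"
  then have T: "T \<in> ssyt S {1..Suc m}" "\<forall>x\<in>S. P x \<longrightarrow> T x \<le> m" by blast+
  then have T1: "T \<in> S \<rightarrow>\<^sub>E {1..Suc m}" by (simp add: ssyt_def)
  then have le: "T x \<le> Suc m" if "x \<in> S" for x
    using that by (auto simp: PiE_iff)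
  have "T \<in> extensional S" using T1 by (simp add: PiE_iff)
  then show "restrict (T(s := Suc m)) S = T"
    using s by (intro ext) (auto simp: extensional_def)
  have "T(s := Suc m) \<in> ssyt (insert s S) {1..Suc m}"
  proof (rule ssyt_extend[OF T(1) s])
    fix r assume r: "(r, snd s) \<in> S"
    then have "T (r, snd s) \<le> m" using column(2) T(2) by blast
    then show "r < fst s \<and> T (r, snd s) < Suc m" using column(1)[OF r] by simp
  qed (use row le in auto)
  moreover have "\<forall>x\<in>S. P x \<longrightarrow> (T(s := Suc m)) x \<le> m"
    using T(2) s by auto
  ultimately show "T(s := Suc m) \<in> ?L" by simp
qed

text \<open>To pass from entries at most \<open>m\<close> to entries at most \<open>m + 1\<close>, the rows are released one after the
  other, from the bottom row upwards: with parameter \<open>t\<close>, the entry \<open>m + 1\<close> is allowed in the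
  lowest \<open>t\<close> rows. Correspondingly the first \<open>t\<close> columns of the determinant are columns of
  \<open>P\<^sub>m\<^sub>+\<^sub>1\<close> and the others are columns of \<open>P\<^sub>m\<close>. The matrix is transposed, because the lemmas
  about \<open>vdet\<close> replace rows.\<close>

definition flagged_tableaux ::
    "nat \<Rightarrow> (nat \<Rightarrow> int) \<Rightarrow> nat \<Rightarrow> nat \<Rightarrow> (nat \<Rightarrow> int) \<Rightarrow> (nat \<times> int \<Rightarrow> nat) set" where
  "flagged_tableaux k f m t g = {T \<in> ssyt (det_shape k f g) {1..Suc m}.
     \<forall>r c. (r, c) \<in> det_shape k f g \<longrightarrow> t \<le> k - r \<longrightarrow> T (r, c) \<le> m}"

definition flagged_det ::
    "(nat \<Rightarrow> int \<Rightarrow> real) \<Rightarrow> nat \<Rightarrow> (nat \<Rightarrow> int) \<Rightarrow> nat \<Rightarrow> nat \<Rightarrow> (nat \<Rightarrow> int) \<Rightarrow> real" where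
  "flagged_det b k f m t g
     = vdet k (\<lambda>q p. gprod b (if q < t then Suc m else m) (f p) (g q))"

definition flagged_sum ::
    "(nat \<Rightarrow> int \<Rightarrow> real) \<Rightarrow> nat \<Rightarrow> (nat \<Rightarrow> int) \<Rightarrow> nat \<Rightarrow> nat \<Rightarrow> (nat \<Rightarrow> int) \<Rightarrow> real" where
  "flagged_sum b k f m t g
     = (\<Sum>T\<in>flagged_tableaux k f m t g. content_weight b (det_shape k f g) T)"

lemma strict_mono_diff_le:
  fixes g :: "nat \<Rightarrow> int"
  assumes "strict_mono_on {..<k} g" "p \<le> q" "q < k"
  shows "g p - int p \<le> g q - int q"
  using assms(2,3)
proof (induction q rule: dec_induct)
  case (step q)
  then have "g q < g (Suc q)" using assms(1) by (auto simp: strict_mono_on_def)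
  then show ?case using step by simp
qed simp

text \<open>Column \<open>t\<close> is expanded by \<open>gprod_Suc\<close>. The second summand vanishes in two cases: if row \<open>k - t\<close>
  of the shape is empty, a block of zeros appears; and if \<open>g (t - 1) = g t - 1\<close>, two columns coincide.\<close>

lemma flagged_det_step:
  assumes f: "strict_mono_on {..<k} f" and g: "strict_mono_on {..<k} g" and t: "t < k"
  shows "flagged_det b k f m (Suc t) g = flagged_det b k f m t g
    + (if f t < g t \<and> (t = 0 \<or> g (t - 1) < g t - 1)
       then b (Suc m) (g t - 1) * flagged_det b k f m (Suc t) (g(t := g t - 1)) else 0)"
    (is "_ = _ + (if ?c then _ else 0)")
proof -
  let ?g = "g(t := g t - 1)" and ?v = "\<lambda>p. gprod b (Suc m) (f p) (g t - 1)"
  let ?h = "\<lambda>q p. gprod b (if q < Suc t then Suc m else m) (f p) (g q)"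
  have "flagged_det b k f m (Suc t) g
      = vdet k (?h(t := \<lambda>p. gprod b m (f p) (g t) + b (Suc m) (g t - 1) * ?v p))"
    unfolding flagged_det_def
    by (rule vdet_cong) (auto simp: gprod_Suc[of b m _ "g t"] simp del: gprod.simps)
  also have "\<dots> = vdet k (?h(t := \<lambda>p. gprod b m (f p) (g t)))
      + b (Suc m) (g t - 1) * vdet k (?h(t := ?v))"
    by (rule vdet_row_add[OF t])
  also have "vdet k (?h(t := \<lambda>p. gprod b m (f p) (g t))) = flagged_det b k f m t g"
    unfolding flagged_det_def by (rule vdet_cong) (auto simp: less_Suc_eq simp del: gprod.simps)
  also have v: "vdet k (?h(t := ?v)) = flagged_det b k f m (Suc t) ?g"
    unfolding flagged_det_def by (rule vdet_cong) (auto simp del: gprod.simps)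
  finally have main: "flagged_det b k f m (Suc t) g = flagged_det b k f m t g
      + b (Suc m) (g t - 1) * flagged_det b k f m (Suc t) ?g" .
  have empty: "flagged_det b k f m (Suc t) ?g = 0" if "\<not> f t < g t"
  proof -
    let ?e = "\<lambda>q p. gprod b (if q < Suc t then Suc m else m) (f p) (?g q)"
    have "vdet k (\<lambda>p q. ?e q p) = 0"
    proof (rule vdet_zero_block[OF t])
      fix p q assume pq: "t \<le> p" "p < k" "q \<le> t"
      have "f t \<le> f p" using f pq by (cases "t = p") (auto simp: strict_mono_on_def less_imp_le)
      moreover have "q < t \<Longrightarrow> g q < g t" using g t by (auto simp: strict_mono_on_def)
      ultimately have "?g q < f p" using pq that by (cases "q = t") auto
      then show "?e q p = 0" by (rule gprod_lower)
    qed
    moreover have "vdet k (\<lambda>p q. ?e q p) = vdet k ?e" by (rule vdet_transpose)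
    ultimately show ?thesis by (simp only: flagged_det_def)
  qed
  have equal: "flagged_det b k f m (Suc t) ?g = 0" if "t \<noteq> 0" "\<not> g (t - 1) < g t - 1"
  proof -
    have "g (t - 1) < g t" using g t that by (auto simp: strict_mono_on_def)
    then have "g (t - 1) = g t - 1" using that by simp
    then show ?thesis unfolding flagged_det_def
      by (intro vdet_equal_rows[of "t - 1" k t]) (use t that in auto)
  qed
  show "flagged_det b k f m (Suc t) g = flagged_det b k f m t g
    + (if ?c then b (Suc m) (g t - 1) * flagged_det b k f m (Suc t) ?g else 0)"
    using main empty equal by (auto simp del: fun_upd_apply)
qed

text \<open>The same recursion for tableaux: either the last entry of row \<open>k - t\<close> is at most \<open>m\<close>, and then
  so is the whole row, or it is \<open>m + 1\<close>, and its square can be removed. The latter requires that the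
  row is not empty and that there is no square below its last one, since entries increase strictly
  down columns.\<close>

lemma flagged_tableaux_step:
  assumes f: "strict_mono_on {..<k} f" and g: "strict_mono_on {..<k} g" and t: "t < k"
  shows "flagged_sum b k f m (Suc t) g = flagged_sum b k f m t g
    + (if f t < g t \<and> (t = 0 \<or> g (t - 1) < g t - 1)
       then b (Suc m) (g t - 1) * flagged_sum b k f m (Suc t) (g(t := g t - 1)) else 0)"
    (is "_ = _ + (if ?c then _ else 0)")
proof -
  let ?S = "det_shape k f g" and ?g = "g(t := g t - 1)"
  let ?S' = "det_shape k f ?g" and ?F = "flagged_tableaux k f m"
  define s where "s = (k - t, g t + int (k - t) - 1)"
  let ?L = "{T \<in> ?F (Suc t) g. s \<in> ?S \<and> T s = Suc m}"
  have row: "k - r = t \<longleftrightarrow> r = k - t" if "1 \<le> r" "r \<le> k" for r using that t by auto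
  have s_in: "s \<in> ?S \<longleftrightarrow> f t < g t" using t by (auto simp: s_def mem_det_shape)
  have fin: "finite (?F u h)" for u h
    unfolding flagged_tableaux_def
    by (rule finite_subset[OF _ finite_ssyt[OF finite_det_shape]]) auto
  have split: "?F (Suc t) g = ?F t g \<union> ?L"
  proof (intro equalityI subsetI)
    fix T assume T: "T \<in> ?F (Suc t) g"
    have "T \<in> ?F t g" if no: "\<not> (s \<in> ?S \<and> T s = Suc m)"
    proof -
      have "T (r, c) \<le> m" if rc: "(r, c) \<in> ?S" "t \<le> k - r" for r c
      proof (cases "k - r = t")
        case True
        then have r: "r = k - t" using rc by (auto simp: mem_det_shape)
        have "f t < g t" "c \<le> snd s" using rc True by (auto simp: mem_det_shape r s_def)
        then have "s \<in> ?S" by (simp add: s_in)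
        then have "T s \<le> Suc m" "T s \<noteq> Suc m" using T no
          by (auto simp: flagged_tableaux_def ssyt_def PiE_iff)
        moreover have "T (r, c) \<le> T s"
          using T rc \<open>s \<in> ?S\<close> \<open>c \<le> snd s\<close> unfolding flagged_tableaux_def ssyt_def r s_def by auto
        ultimately show ?thesis by simp
      next
        case False
        then show ?thesis using T rc by (auto simp: flagged_tableaux_def)
      qed
      then show ?thesis using T by (auto simp: flagged_tableaux_def)
    qed
    then show "T \<in> ?F t g \<union> ?L" using T by blast
  next
    fix T assume "T \<in> ?F t g \<union> ?L"
    then show "T \<in> ?F (Suc t) g" by (auto simp: flagged_tableaux_def)
  qed
  have disj: "?F t g \<inter> ?L = {}"
    using t by (auto simp: flagged_tableaux_def s_def dest!: spec[of _ "k - t"])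
  have "flagged_sum b k f m (Suc t) g = flagged_sum b k f m t g + (\<Sum>T\<in>?L. content_weight b ?S T)"
    unfolding flagged_sum_def
    by (rule trans[OF sum.cong[OF split refl] sum.union_disjoint]) (use fin disj in auto)
  also have "(\<Sum>T\<in>?L. content_weight b ?S T)
      = (if ?c then b (Suc m) (g t - 1) * flagged_sum b k f m (Suc t) ?g else 0)"
  proof (cases ?c)
    case False
    have "?L = {}"
    proof (rule ccontr)
      assume "?L \<noteq> {}"
      then obtain T where T: "T \<in> ?F (Suc t) g" "s \<in> ?S" "T s = Suc m" by auto
      then have "f t < g t" "t \<noteq> 0" "\<not> g (t - 1) < g t - 1" using False s_in by auto
      moreover have "g (t - 1) < g t" "f (t - 1) < f t"
        using f g t \<open>t \<noteq> 0\<close> by (auto simp: strict_mono_on_def)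
      moreover have "k - Suc (k - t) = t - 1" using t \<open>t \<noteq> 0\<close> by simp
      ultimately have below: "(Suc (k - t), snd s) \<in> ?S"
        using t by (auto simp: mem_det_shape s_def)
      have "T \<in> ssyt ?S {1..Suc m}" using T(1) by (simp add: flagged_tableaux_def)
      then have "(fst s, snd s) \<in> ?S \<longrightarrow> (Suc (k - t), snd s) \<in> ?S \<longrightarrow> fst s < Suc (k - t)
          \<longrightarrow> T (fst s, snd s) < T (Suc (k - t), snd s)"
        unfolding ssyt_def by blast
      then have "T s < T (Suc (k - t), snd s)"
        using below T(2) by (simp add: s_def)
      moreover have "T (Suc (k - t), snd s) \<le> Suc m"
        using T(1) below by (auto simp: flagged_tableaux_def ssyt_def PiE_iff)
      ultimately show False using T(3) by simp
    qed
    then show ?thesis using False by (simp only: if_False sum.empty)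
  next
    case True
    then have s: "s \<in> ?S" using s_in by simp
    have "x \<in> ?S \<longleftrightarrow> x = s \<or> x \<in> ?S'" for x
    proof -
      obtain r c where x: "x = (r, c)" by (cases x)
      show ?thesis
      proof (cases "r = k - t")
        case True
        then have "1 \<le> r" "r \<le> k" "k - r = t" using t by auto
        then show ?thesis using \<open>?c\<close> True by (simp add: x mem_det_shape s_def) linarith
      next
        case False
        then have "1 \<le> r \<Longrightarrow> r \<le> k \<Longrightarrow> ?g (k - r) = g (k - r)" using row by auto
        then show ?thesis using False by (simp add: x mem_det_shape s_def) metis
      qed
    qed
    then have S: "?S = insert s ?S'" by blast
    have s': "s \<notin> ?S'" using t by (simp add: mem_det_shape s_def)
    have nobelow: "r \<le> k - t" if "(r, snd s) \<in> ?S" for r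
    proof (rule ccontr)
      assume "\<not> r \<le> k - t"
      then have r: "k - r < t" "r \<le> k" "1 \<le> r" using that t by (auto simp: mem_det_shape)
      have "snd s \<le> g (k - r) + int r - 1" using that by (simp add: mem_det_shape)
      moreover have "g (k - r) - int (k - r) \<le> g (t - 1) - int (t - 1)"
        by (rule strict_mono_diff_le[OF g]) (use r t in auto)
      moreover have "int (k - r) = int k - int r" "int (t - 1) = int t - 1" "int (k - t) = int k - int t"
        using r t by auto
      ultimately show False using True r t by (simp add: s_def)
    qed
    have right: "c \<le> snd s" if "(k - t, c) \<in> ?S" for c
      using that t by (simp add: mem_det_shape s_def)
    have memL: "T \<in> ?L \<longleftrightarrow> T \<in> ssyt (insert s ?S') {1..Suc m} \<and> T s = Suc m
        \<and> (\<forall>x\<in>?S'. Suc t \<le> k - fst x \<longrightarrow> T x \<le> m)" for T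
    proof -
      have "(\<forall>r c. (r, c) \<in> ?S \<longrightarrow> Suc t \<le> k - r \<longrightarrow> T (r, c) \<le> m)
          \<longleftrightarrow> (\<forall>x\<in>?S. Suc t \<le> k - fst x \<longrightarrow> T x \<le> m)"
        by (metis fst_conv prod.collapse)
      also have "\<dots> \<longleftrightarrow> (\<forall>x\<in>insert s ?S'. Suc t \<le> k - fst x \<longrightarrow> T x \<le> m)"
        by (simp only: S)
      also have "\<dots> \<longleftrightarrow> (\<forall>x\<in>?S'. Suc t \<le> k - fst x \<longrightarrow> T x \<le> m)"
        using t by (simp add: s_def)
      finally have "(\<forall>r c. (r, c) \<in> ?S \<longrightarrow> Suc t \<le> k - r \<longrightarrow> T (r, c) \<le> m)
          \<longleftrightarrow> (\<forall>x\<in>?S'. Suc t \<le> k - fst x \<longrightarrow> T x \<le> m)" .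
      moreover have "T \<in> ssyt ?S {1..Suc m} \<longleftrightarrow> T \<in> ssyt (insert s ?S') {1..Suc m}"
        by (simp only: S)
      ultimately show ?thesis using s unfolding flagged_tableaux_def by blast
    qed
    have memF: "T \<in> ?F (Suc t) ?g \<longleftrightarrow> T \<in> ssyt ?S' {1..Suc m}
        \<and> (\<forall>x\<in>?S'. Suc t \<le> k - fst x \<longrightarrow> T x \<le> m)" for T
      unfolding flagged_tableaux_def by fastforce
    have right': "c \<le> snd s" if "(fst s, c) \<in> ?S'" for c
    proof -
      have "(k - t, c) \<in> ?S" using that unfolding S by (simp add: s_def)
      then show ?thesis by (rule right)
    qed
    have above': "r < fst s" "Suc t \<le> k - fst (r, snd s)" if "(r, snd s) \<in> ?S'" for r
    proof -
      have "(r, snd s) \<in> ?S" using that unfolding S by simp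
      then have "r \<le> k - t" by (rule nobelow)
      moreover have "r \<noteq> k - t" using that s' by (auto simp: s_def)
      ultimately show "r < fst s" "Suc t \<le> k - fst (r, snd s)" using t by (auto simp: s_def)
    qed
    have L: "?L = {T \<in> ssyt (insert s ?S') {1..Suc m}. T s = Suc m
        \<and> (\<forall>x\<in>?S'. Suc t \<le> k - fst x \<longrightarrow> T x \<le> m)}"
      using memL by blast
    have F: "?F (Suc t) ?g = {T \<in> ssyt ?S' {1..Suc m}. \<forall>x\<in>?S'. Suc t \<le> k - fst x \<longrightarrow> T x \<le> m}"
      using memF by blast
    have "snd s - int (fst s) = g t - 1" by (simp add: s_def)
    then have "(\<Sum>T\<in>?L. content_weight b (insert s ?S') T)
        = b (Suc m) (g t - 1) * (\<Sum>T\<in>?F (Suc t) ?g. content_weight b ?S' T)"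
      unfolding L F
      by (subst sum_ssyt_corner[where s = s and S = ?S'])
        (rule finite_det_shape s' right' above' | assumption | simp only:)+
    then show ?thesis unfolding if_P[OF True] flagged_sum_def by (simp only: S)
  qed
  finally show ?thesis .
qed

lemma flagged_det_0: "flagged_det b k f m 0 g = pminor k (gprod b m) f g"
proof -
  have "flagged_det b k f m 0 g = vdet k (\<lambda>q p. gprod b m (f p) (g q))"
    by (simp add: flagged_det_def)
  also have "\<dots> = pminor k (gprod b m) f g" unfolding pminor_def by (rule vdet_transpose)
  finally show ?thesis .
qed

lemma flagged_sum_0:
  "flagged_sum b k f m 0 g
     = (\<Sum>T\<in>ssyt (det_shape k f g) {1..m}. content_weight b (det_shape k f g) T)"
proof -
  have "flagged_tableaux k f m 0 g = ssyt (det_shape k f g) {1..m}"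
    unfolding flagged_tableaux_def ssyt_def by (fastforce simp: PiE_iff)
  then show ?thesis by (simp add: flagged_sum_def)
qed

lemma flagged_det_Suc_0: "flagged_det b k f (Suc m) 0 g = flagged_det b k f m k g"
  unfolding flagged_det_def by (rule vdet_cong) (simp del: gprod.simps)

lemma flagged_sum_Suc_0: "flagged_sum b k f (Suc m) 0 g = flagged_sum b k f m k g"
proof -
  have "flagged_tableaux k f m k g = ssyt (det_shape k f g) {1..Suc m}"
    by (auto simp: flagged_tableaux_def mem_det_shape)
  then show ?thesis by (simp add: flagged_sum_0) (simp add: flagged_sum_def)
qed

text \<open>The empty product: the identity matrix has the minor \<open>1\<close> if \<open>f = g\<close>, when the shape is empty, and
  a zero row at the first difference of \<open>f\<close> and \<open>g\<close> otherwise.\<close>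

lemma flagged_det_eq_sum_base:
  assumes f: "strict_mono_on {..<k} f" and g: "strict_mono_on {..<k} g"
    and le: "\<And>p. p < k \<Longrightarrow> f p \<le> g p"
  shows "flagged_det b k f 0 0 g = flagged_sum b k f 0 0 g"
proof (cases "\<forall>p<k. f p = g p")
  case True
  have inj: "f p \<noteq> f q" if "p < q" "q < k" for p q
  proof -
    have "f p < f q" using f that by (auto simp: strict_mono_on_def)
    then show ?thesis by simp
  qed
  have "flagged_det b k f 0 0 g = 1"
    unfolding flagged_det_def
    by (rule vdet_upper_unitriangular) (use True inj in \<open>auto simp: zmat_one_def\<close>)
  moreover have "det_shape k f g = {}" using True by (auto simp: mem_det_shape)
  ultimately show ?thesis by (simp add: flagged_sum_0 ssyt_def content_weight_def)
next
  case False
  define t where "t = (LEAST p. p < k \<and> f p \<noteq> g p)"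
  have t: "t < k" "f t \<noteq> g t" unfolding t_def using LeastI_ex[of "\<lambda>p. p < k \<and> f p \<noteq> g p"] False by auto
  have least: "f q = g q" if "q < t" for q
    using not_less_Least[of q "\<lambda>p. p < k \<and> f p \<noteq> g p"] that t(1) by (auto simp: t_def)
  have "f t < g t" using le t by (simp add: order_less_le)
  have "f t \<noteq> g q" if "q < k" for q
  proof (cases "q < t")
    case True
    then have "f q < f t" using f t by (auto simp: strict_mono_on_def)
    then show ?thesis using least[OF True] by simp
  next
    case False
    then have "g t \<le> g q"
      using g that by (cases "q = t") (auto simp: strict_mono_on_def less_imp_le)
    then show ?thesis using \<open>f t < g t\<close> by simp
  qed
  then have "pminor k (gprod b 0) f g = 0"
    unfolding pminor_def using t(1) by (intro vdet_zero_row[of t]) (auto simp: zmat_one_def)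
  moreover have "(k - t, g t + int (k - t) - 1) \<in> det_shape k f g"
    using t(1) \<open>f t < g t\<close> by (simp add: mem_det_shape)
  then have "ssyt (det_shape k f g) {1..0} = {}" by (auto simp: ssyt_def PiE_iff)
  ultimately show ?thesis by (simp add: flagged_det_0 flagged_sum_0 del: gprod.simps)
qed

lemma flagged_det_eq_sum_row:
  assumes f: "strict_mono_on {..<k} f" and t: "t < k"
    and prev: "\<And>g. strict_mono_on {..<k} g \<Longrightarrow> (\<And>p. p < k \<Longrightarrow> f p \<le> g p)
      \<Longrightarrow> flagged_det b k f m t g = flagged_sum b k f m t g"
    and g: "strict_mono_on {..<k} g" and le: "\<And>p. p < k \<Longrightarrow> f p \<le> g p"
  shows "flagged_det b k f m (Suc t) g = flagged_sum b k f m (Suc t) g"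
  using g le
proof (induction "nat (g t - f t)" arbitrary: g rule: less_induct)
  case less
  let ?c = "f t < g t \<and> (t = 0 \<or> g (t - 1) < g t - 1)" and ?g = "g(t := g t - 1)"
  have "flagged_det b k f m (Suc t) ?g = flagged_sum b k f m (Suc t) ?g" if ?c
  proof (rule less.hyps)
    have mono: "g p < g q" if "p < q" "q < k" for p q
      using less.prems(1) that by (auto simp: strict_mono_on_def)
    show "strict_mono_on {..<k} ?g"
    proof (rule strict_mono_onI)
      fix p q assume pq: "p \<in> {..<k}" "q \<in> {..<k}" "p < q"
      have "q = t \<Longrightarrow> p = t - 1 \<or> g p < g (t - 1)" using mono[of p "t - 1"] pq t
        by (cases "p = t - 1") auto
      then show "?g p < ?g q" using pq mono[of p q] \<open>?c\<close> by (cases "q = t") auto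
    qed
    show "f p \<le> ?g p" if "p < k" for p using less.prems(2)[OF that] \<open>?c\<close> by auto
    show "nat (?g t - f t) < nat (g t - f t)" using \<open>?c\<close> by simp
  qed
  then show ?case
    unfolding flagged_det_step[OF f less.prems(1) t] flagged_tableaux_step[OF f less.prems(1) t]
    using prev[OF less.prems] by (cases ?c) (simp_all only: if_P if_not_P not_False_eq_True)
qed

lemma flagged_det_eq_sum:
  assumes f: "strict_mono_on {..<k} f" and g: "strict_mono_on {..<k} g"
    and le: "\<And>p. p < k \<Longrightarrow> f p \<le> g p" and t: "t \<le> k"
  shows "flagged_det b k f m t g = flagged_sum b k f m t g"
  using g le t
proof (induction m arbitrary: t g)
  case (0 t g)
  then show ?case
  proof (induction t arbitrary: g)
    case 0
    then show ?case using flagged_det_eq_sum_base[OF f] by blast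
  next
    case (Suc t g)
    have "flagged_det b k f 0 t g = flagged_sum b k f 0 t g"
      if "strict_mono_on {..<k} g" "\<And>p. p < k \<Longrightarrow> f p \<le> g p" for g
      using Suc.IH[OF that] Suc.prems(3) by simp
    then show ?case using flagged_det_eq_sum_row[OF f] Suc.prems by (metis Suc_le_lessD)
  qed
next
  case (Suc m t g)
  have base: "flagged_det b k f (Suc m) 0 g = flagged_sum b k f (Suc m) 0 g"
    if "strict_mono_on {..<k} g" "\<And>p. p < k \<Longrightarrow> f p \<le> g p" for g
    using Suc.IH[OF that] by (simp add: flagged_det_Suc_0 flagged_sum_Suc_0)
  from Suc.prems show ?case
  proof (induction t arbitrary: g)
    case 0
    then show ?case using base by blast
  next
    case (Suc t g)
    have "flagged_det b k f (Suc m) t g = flagged_sum b k f (Suc m) t g"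
      if "strict_mono_on {..<k} g" "\<And>p. p < k \<Longrightarrow> f p \<le> g p" for g
      using Suc.IH[OF that] Suc.prems(3) by simp
    then show ?case using flagged_det_eq_sum_row[OF f] Suc.prems by (metis Suc_le_lessD)
  qed
qed

theorem pminor_gprod_eq_tableau_sum:
  assumes "strict_mono_on {..<k} f" "strict_mono_on {..<k} g" "\<And>p. p < k \<Longrightarrow> f p \<le> g p"
  shows "pminor k (gprod b m) f g
    = (\<Sum>T\<in>ssyt (det_shape k f g) {1..m}. content_weight b (det_shape k f g) T)"
  using flagged_det_eq_sum[OF assms, of 0 b m] by (simp add: flagged_det_0 flagged_sum_0)

section \<open>Products of curls and the ASW factorization\<close>

lemma gprod_nonneg:
  assumes "\<And>m j. b (Suc m) j \<ge> 0"
  shows "gprod b m i j \<ge> 0"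
  by (induction m arbitrary: i j)
    (auto simp: zmat_one_def zmat_mult_def gcurl_def intro!: sum_nonneg mult_nonneg_nonneg prod_nonneg assms)

text \<open>The row form of \<open>M(-b\<^sub>1) P\<^sub>m\<^sub>+\<^sub>1 = P'\<^sub>m\<close>, where \<open>P'\<close> is the product without the first curl.\<close>

lemma gprod_left:
  "gprod b (Suc m) i j = gprod (\<lambda>m. b (Suc m)) m i j + b 1 i * gprod b (Suc m) (i + 1) j"
proof (induction m arbitrary: j)
  case 0
  have curl: "gprod b (Suc 0) i j = gcurl (b 1) i j" for i
  proof -
    have "gprod b (Suc 0) i j = (\<Sum>t\<in>{i..j}. if t = i then gcurl (b 1) i j else 0)"
      unfolding gprod.simps zmat_mult_def by (intro sum.cong) (auto simp: zmat_one_def)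
    then show ?thesis by (simp add: gcurl_def)
  qed
  show ?case
  proof (cases "i < j")
    case True
    then have "{i..<j} = insert i {i + 1..<j}" by auto
    then show ?thesis using True unfolding curl by (simp add: gcurl_def zmat_one_def)
  next
    case False
    then show ?thesis unfolding curl by (simp add: gcurl_def zmat_one_def)
  qed
next
  case (Suc m)
  let ?P = "gprod b (Suc (Suc m))" and ?Q = "gprod (\<lambda>m. b (Suc m)) (Suc m)"
  have low: "?P i j = ?Q i j + b 1 i * ?P (i + 1) j" if "j < i" for j
    using that by (simp add: gprod_lower del: gprod.simps)
  have "?P i j = ?Q i j + b 1 i * ?P (i + 1) j" if "i - 1 \<le> j" for j
    using that
  proof (induction j rule: int_ge_induct)
    case base
    then show ?case by (rule low) simp
  next
    case (step j)
    have "?P i (j + 1) = gprod b (Suc m) i (j + 1) + b (Suc (Suc m)) j * ?P i j"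
      "?P (i + 1) (j + 1) = gprod b (Suc m) (i + 1) (j + 1) + b (Suc (Suc m)) j * ?P (i + 1) j"
      "?Q i (j + 1) = gprod (\<lambda>m. b (Suc m)) m i (j + 1) + b (Suc (Suc m)) j * ?Q i j"
      using gprod_Suc[of b "Suc m" _ "j + 1"] gprod_Suc[of "\<lambda>m. b (Suc m)" m i "j + 1"]
      by (simp_all del: gprod.simps)
    then show ?case using Suc[of "j + 1"] step.IH by (simp add: algebra_simps del: gprod.simps)
  qed
  then show ?case using low by (cases "j < i") (auto simp del: gprod.simps)
qed

text \<open>\<open>T\<close> is the sequence of remaining factors of \<open>T 0\<close> when curls are split off from the left. The
  assumption \<open>rec\<close> states \<open>T m = N(b\<^sub>m\<^sub>+\<^sub>1) T (m + 1)\<close> row by row.\<close>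

lemma gprod_times_tail:
  assumes rec: "\<And>m i j. T m i j = T (Suc m) i j + b (Suc m) i * T m (i + 1) j"
    and low: "\<And>m i j. j < i \<Longrightarrow> T m i j = (0::real)"
  shows "T 0 i j = (\<Sum>t\<in>{i..j}. gprod b m i t * T m t j)"
proof (induction m)
  case 0
  have "(\<Sum>t\<in>{i..j}. gprod b 0 i t * T 0 t j) = (\<Sum>t\<in>{i..j}. if t = i then T 0 i j else 0)"
    unfolding gprod.simps by (intro sum.cong) (auto simp: zmat_one_def)
  then show ?case using low by simp
next
  case (Suc m)
  let ?P = "gprod b (Suc m) i" and ?b = "b (Suc m)"
  have shift: "(\<Sum>t\<in>{i..j}. ?P t * ?b t * T m (t + 1) j)
      = (\<Sum>t\<in>{i..j}. ?b (t - 1) * ?P (t - 1) * T m t j)"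
  proof -
    have "(\<Sum>t\<in>{i..j}. ?P t * ?b t * T m (t + 1) j)
        = (\<Sum>t\<in>{i + 1..j + 1}. ?b (t - 1) * ?P (t - 1) * T m t j)"
      by (rule sum.reindex_bij_witness[where i = "\<lambda>t. t - 1" and j = "\<lambda>t. t + 1"])
        (auto simp: mult_ac simp del: gprod.simps)
    also have "\<dots> = (\<Sum>t\<in>{i..j + 1}. ?b (t - 1) * ?P (t - 1) * T m t j)"
      by (rule sum.mono_neutral_left) (auto simp: gprod_lower simp del: gprod.simps)
    also have "\<dots> = (\<Sum>t\<in>{i..j}. ?b (t - 1) * ?P (t - 1) * T m t j)"
      by (rule sum.mono_neutral_right) (auto simp: low simp del: gprod.simps)
    finally show ?thesis .
  qed
  have "gprod b m i t = ?P t - ?b (t - 1) * ?P (t - 1)" for t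
    using gprod_Suc[of b m i t] by linarith
  then have "T 0 i j = (\<Sum>t\<in>{i..j}. (?P t - ?b (t - 1) * ?P (t - 1)) * T m t j)"
    using Suc by (simp only:)
  also have "\<dots> = (\<Sum>t\<in>{i..j}. ?P t * T m t j) - (\<Sum>t\<in>{i..j}. ?P t * ?b t * T m (t + 1) j)"
    unfolding shift by (simp only: left_diff_distrib sum_subtractf)
  also have "\<dots> = (\<Sum>t\<in>{i..j}. ?P t * (T m t j - ?b t * T m (t + 1) j))"
    by (simp only: right_diff_distrib sum_subtractf mult.assoc)
  also have "\<dots> = (\<Sum>t\<in>{i..j}. ?P t * T (Suc m) t j)"
  proof (intro sum.cong refl arg_cong2[where f = "(*)"])
    show "T m t j - ?b t * T m (t + 1) j = T (Suc m) t j" for t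
      using rec[of m t j] by linarith
  qed
  finally show ?case .
qed

text \<open>Infinite products of curls are handled through their tails \<open>T m\<close>, that is, what remains after the
  first \<open>m\<close> curls have been removed. In this form no limit enters the algebra; convergence of the
  product is equivalent to the tails tending to the identity matrix (\<open>gprod_tendsto\<close>,
  \<open>curl_tails_of_gprod_tendsto\<close>).\<close>

locale curl_tails =
  fixes b :: "nat \<Rightarrow> int \<Rightarrow> real" and T :: "nat \<Rightarrow> zmat"
  assumes pos: "b (Suc m) j > 0"
    and rec: "T m i j = T (Suc m) i j + b (Suc m) i * T m (i + 1) j"
    and lower: "j < i \<Longrightarrow> T m i j = 0"
    and diag: "T m i i = 1"
    and nonneg: "T m i j \<ge> 0"
    and vanish: "i < j \<Longrightarrow> (\<lambda>m. T m i j) \<longlonglongrightarrow> 0"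
begin

lemma shift: "curl_tails (\<lambda>m. b (m + r)) (\<lambda>m. T (m + r))"
proof
  show "i < j \<Longrightarrow> (\<lambda>m. T (m + r) i j) \<longlonglongrightarrow> 0" for i j
    by (rule LIMSEQ_ignore_initial_segment[OF vanish])
  show "T (m + r) i j = T (Suc m + r) i j + b (Suc m + r) i * T (m + r) (i + 1) j" for m i j
    using rec[of "m + r" i j] unfolding add_Suc .
qed (simp_all add: pos lower diag nonneg)

lemma factor: "T 0 i j = (\<Sum>t\<in>{i..j}. gprod b m i t * T m t j)"
  by (rule gprod_times_tail) (rule rec, rule lower)

lemma gprod_nonneg': "gprod b m i j \<ge> 0"
  by (rule gprod_nonneg) (use pos in \<open>auto intro: less_imp_le\<close>)

lemma gprod_le: "gprod b m i j \<le> T 0 i j"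
proof (cases "i \<le> j")
  case True
  have "(\<Sum>t\<in>{j}. gprod b m i t * T m t j) \<le> (\<Sum>t\<in>{i..j}. gprod b m i t * T m t j)"
    by (rule sum_mono2) (use True nonneg gprod_nonneg' in auto)
  then show ?thesis using factor[of i j m] by (simp add: diag)
qed (simp add: gprod_lower lower)

lemma gprod_tendsto: "(\<lambda>m. gprod b m i j) \<longlonglongrightarrow> T 0 i j"
proof (cases "i \<le> j")
  case True
  have diff: "T 0 i j - gprod b m i j \<le> (\<Sum>t\<in>{i..<j}. T 0 i t * T m t j)" for m
  proof -
    have "{i..j} = insert j {i..<j}" using True by auto
    then have "T 0 i j - gprod b m i j = (\<Sum>t\<in>{i..<j}. gprod b m i t * T m t j)"
      using factor[of i j m] by (simp add: diag)
    also have "\<dots> \<le> (\<Sum>t\<in>{i..<j}. T 0 i t * T m t j)"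
      by (intro sum_mono mult_right_mono gprod_le nonneg)
    finally show ?thesis .
  qed
  have "(\<lambda>m. \<Sum>t\<in>{i..<j}. T 0 i t * T m t j) \<longlonglongrightarrow> (\<Sum>t\<in>{i..<j}. T 0 i t * 0)"
    by (intro tendsto_sum tendsto_mult tendsto_const vanish) auto
  then have "(\<lambda>m. T 0 i j - gprod b m i j) \<longlonglongrightarrow> 0"
    by (intro tendsto_sandwich[of "\<lambda>_. 0" "\<lambda>m. T 0 i j - gprod b m i j"]) (use diff gprod_le in auto)
  then have "(\<lambda>m. T 0 i j - (T 0 i j - gprod b m i j)) \<longlonglongrightarrow> T 0 i j - 0"
    by (intro tendsto_diff tendsto_const)
  then show ?thesis by simp
qed (simp add: gprod_lower lower)

end

lemma content_weight_nonneg: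
  assumes "\<And>m j. b (Suc m) j \<ge> 0" "T \<in> ssyt S {1..}"
  shows "content_weight b S T \<ge> 0"
  unfolding content_weight_def
proof (rule prod_nonneg)
  fix s assume "s \<in> S"
  then have "T s \<ge> 1" using assms(2) by (auto simp: ssyt_def PiE_iff)
  then show "b (T s) (snd s - int (fst s)) \<ge> 0" using assms(1)[of "T s - 1"] by simp
qed

lemma ssyt_mono: "A \<subseteq> B \<Longrightarrow> ssyt S A \<subseteq> ssyt S B"
  by (auto simp: ssyt_def PiE_iff)

text \<open>Filling row \<open>r\<close> with the entry \<open>r\<close> shows that there is a tableau with entries in \<open>{1..k}\<close>, so that
  the minors are positive and not just nonnegative.\<close>

lemma row_filling_ssyt:
  assumes "S = det_shape k f g"
  shows "restrict fst S \<in> ssyt S {1..k}"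
  unfolding assms ssyt_def by (auto simp: mem_det_shape)

context curl_tails
begin

lemma tableau_sum_mono:
  assumes "finite S" "m \<le> m'"
  shows "(\<Sum>U\<in>ssyt S {1..m}. content_weight b S U) \<le> (\<Sum>U\<in>ssyt S {1..m'}. content_weight b S U)"
proof (rule sum_mono2)
  show "0 \<le> content_weight b S U" if "U \<in> ssyt S {1..m'} - ssyt S {1..m}" for U
    by (rule content_weight_nonneg)
      (use that ssyt_mono[of "{1..m'}" "{1..}" S] pos in \<open>auto intro: less_imp_le\<close>)
qed (use assms in \<open>auto intro!: finite_ssyt ssyt_mono\<close>)

lemma pminor_tendsto: "(\<lambda>m. pminor k (gprod b m) f g) \<longlonglongrightarrow> pminor k (T 0) f g"
  unfolding pminor_def by (rule tendsto_vdet) (rule gprod_tendsto)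

lemma pminor_tableaux_tendsto:
  assumes "strict_mono_on {..<k} f" "strict_mono_on {..<k} g" "\<And>p. p < k \<Longrightarrow> f p \<le> g p"
  defines "S \<equiv> det_shape k f g"
  shows "(\<lambda>m. \<Sum>U\<in>ssyt S {1..m}. content_weight b S U) \<longlonglongrightarrow> pminor k (T 0) f g"
  unfolding S_def using pminor_tendsto[of k f g] pminor_gprod_eq_tableau_sum[OF assms(1-3)] by simp

lemma pminor_pos_0:
  assumes "strict_mono_on {..<k} f" "strict_mono_on {..<k} g" "\<And>p. p < k \<Longrightarrow> f p \<le> g p"
  shows "pminor k (T 0) f g > 0"
proof -
  let ?S = "det_shape k f g" and ?U = "restrict fst (det_shape k f g)"
  let ?s = "\<lambda>m. \<Sum>U\<in>ssyt ?S {1..m}. content_weight b ?S U"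
  have U: "?U \<in> ssyt ?S {1..k}" by (rule row_filling_ssyt) simp
  have nn: "content_weight b ?S V \<ge> 0" if "V \<in> ssyt ?S {1..k}" for V
    by (rule content_weight_nonneg)
      (use that ssyt_mono[of "{1..k}" "{1..}" ?S] pos in \<open>auto intro: less_imp_le\<close>)
  have lim: "?s \<longlonglongrightarrow> pminor k (T 0) f g"
    by (rule pminor_tableaux_tendsto[OF assms(1,2)]) (rule assms(3))
  have "content_weight b ?S ?U > 0"
    unfolding content_weight_def
  proof (rule prod_pos)
    fix s assume s: "s \<in> ?S"
    then have "?U s = Suc (fst s - 1)" by (cases s) (auto simp: mem_det_shape)
    then show "b (?U s) (snd s - int (fst s)) > 0" by (simp only: pos)
  qed
  moreover have "content_weight b ?S ?U \<le> ?s k"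
    by (rule member_le_sum[OF U]) (use nn in \<open>auto intro!: finite_ssyt finite_det_shape\<close>)
  moreover have "?s k \<le> pminor k (T 0) f g"
    by (rule LIMSEQ_le_const[OF lim])
      (intro exI[of _ k] allI impI tableau_sum_mono finite_det_shape)
  ultimately show ?thesis by linarith
qed

lemma tp: "triangular_tp (T m)"
proof -
  interpret s: curl_tails "\<lambda>i. b (i + m)" "\<lambda>i. T (i + m)" by (rule shift)
  show ?thesis using s.pminor_pos_0 by (auto simp: triangular_tp_def)
qed

end

text \<open>Tails are obtained from the limit by multiplying with the inverses of the curls, and are identified
  as limits of shifted products. They tend to \<open>0\<close> above the diagonal because
  \<open>X i j \<ge> gprod b m i j + T m i j\<close>.\<close>

lemma curl_tails_of_gprod_tendsto:
  assumes pos: "\<And>m j. b (Suc m) j > 0" and lim: "\<And>i j. (\<lambda>m. gprod b m i j) \<longlonglongrightarrow> X i j"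
  obtains T where "curl_tails b T" "T 0 = X"
proof -
  define T where "T = rec_nat X (\<lambda>m Y i j. Y i j - b (Suc m) i * Y (i + 1) j)"
  have T0: "T 0 = X" and TS: "T (Suc m) i j = T m i j - b (Suc m) i * T m (i + 1) j" for m i j
    by (simp_all add: T_def)
  have Tlim: "(\<lambda>m. gprod (\<lambda>s. b (s + r)) m i j) \<longlonglongrightarrow> T r i j" for r i j
  proof (induction r arbitrary: i j)
    case 0
    then show ?case using lim by (simp add: T0)
  next
    case (Suc r)
    have "(\<lambda>m. gprod (\<lambda>s. b (s + r)) (Suc m) i j - b (Suc r) i * gprod (\<lambda>s. b (s + r)) (Suc m) (i + 1) j)
        \<longlonglongrightarrow> T r i j - b (Suc r) i * T r (i + 1) j"
      by (intro tendsto_diff tendsto_mult tendsto_const LIMSEQ_Suc Suc)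
    moreover have "gprod (\<lambda>s. b (s + r)) (Suc m) i j - b (Suc r) i * gprod (\<lambda>s. b (s + r)) (Suc m) (i + 1) j
        = gprod (\<lambda>s. b (s + Suc r)) m i j" for m
      using gprod_left[of "\<lambda>s. b (s + r)" m i j] by (simp del: gprod.simps)
    ultimately show ?case by (simp only: TS)
  qed
  have low: "T m i j = 0" if "j < i" for m i j
    using Tlim[of m i j] that by (simp add: gprod_lower LIMSEQ_const_iff)
  have dia: "T m i i = 1" for m i
    using Tlim[of m i i] by (simp add: gprod_diag LIMSEQ_const_iff)
  have nn: "T m i j \<ge> 0" for m i j
    by (rule LIMSEQ_le_const[OF Tlim]) (use pos in \<open>auto intro!: exI[of _ 0] gprod_nonneg intro: less_imp_le\<close>)
  have rec: "T m i j = T (Suc m) i j + b (Suc m) i * T m (i + 1) j" for m i j by (simp add: TS)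
  have "curl_tails b T"
  proof
    fix i j :: int assume ij: "i < j"
    have "T m i j \<le> X i j - gprod b m i j" for m
    proof -
      have "X i j = (\<Sum>t\<in>{i..j}. gprod b m i t * T m t j)"
        unfolding T0[symmetric] by (rule gprod_times_tail) (rule rec, rule low)
      moreover have "(\<Sum>t\<in>{i, j}. gprod b m i t * T m t j) \<le> (\<Sum>t\<in>{i..j}. gprod b m i t * T m t j)"
        by (rule sum_mono2) (use ij nn pos in \<open>auto intro!: mult_nonneg_nonneg gprod_nonneg intro: less_imp_le\<close>)
      ultimately show ?thesis using ij by (simp add: gprod_diag dia)
    qed
    moreover have "(\<lambda>m. X i j - gprod b m i j) \<longlonglongrightarrow> X i j - X i j"
      by (intro tendsto_diff tendsto_const lim)
    ultimately show "(\<lambda>m. T m i j) \<longlonglongrightarrow> 0"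
      by (intro tendsto_sandwich[of "\<lambda>_. 0" "\<lambda>m. T m i j"]) (use nn in auto)
  qed (rule pos rec low dia nn | assumption)+
  then show thesis using that T0 by blast
qed

lemma pminor_1: "pminor (Suc 0) X f g = X (f 0) (g 0)"
proof -
  have "vdet (Suc 0) h = h 0 0" for h by (simp add: vdet_def det_single)
  then show ?thesis by (simp add: pminor_def)
qed

lemma strict_mono_on_singleton: "strict_mono_on {..<Suc 0} f"
  by (auto simp: strict_mono_on_def)

lemma triangular_tp_entry_pos: "triangular_tp X \<Longrightarrow> i \<le> j \<Longrightarrow> X i j > 0"
  using triangular_tpD[of X "Suc 0" "\<lambda>_. i" "\<lambda>_. j"]
  by (simp add: pminor_1 strict_mono_on_singleton)

lemma row_ratio_antimono:
  assumes "triangular_tp X" "i < l" "l \<le> l'"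
  shows "X i l' / X (i + 1) l' \<le> X i l / X (i + 1) l"
  using minor_ratio_antimono[of X "Suc 0" "\<lambda>_. i" "\<lambda>_. i + 1" "\<lambda>_. l" "\<lambda>_. l'" "i + 1"] assms
  by (simp add: pminor_1 strict_mono_on_singleton)

lemma
  assumes X: "triangular_tp X"
  shows epsilon_tendsto: "(\<lambda>l. X i (int l) / X (i + 1) (int l)) \<longlonglongrightarrow> epsilon X i"
    and epsilon_nonneg: "epsilon X i \<ge> 0"
proof -
  let ?r = "\<lambda>l. X i (int l) / X (i + 1) (int l)" and ?N = "nat (i + 1)"
  have "decseq (\<lambda>l. ?r (l + ?N))"
    by (intro decseq_SucI row_ratio_antimono[OF X]) auto
  moreover have nn: "0 \<le> ?r (l + ?N)" for l
    by (intro divide_nonneg_nonneg less_imp_le[OF triangular_tp_entry_pos[OF X]]) auto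
  ultimately obtain L where "(\<lambda>l. ?r (l + ?N)) \<longlonglongrightarrow> L"
    using decseq_convergent[of "\<lambda>l. ?r (l + ?N)" 0] by blast
  then have L: "?r \<longlonglongrightarrow> L" by (rule LIMSEQ_offset)
  then have "epsilon X i = L" unfolding epsilon_def by (rule limI)
  then show lim: "?r \<longlonglongrightarrow> epsilon X i" using L by simp
  show "epsilon X i \<ge> 0"
    by (rule LIMSEQ_le_const[OF LIMSEQ_ignore_initial_segment[OF lim, of ?N]]) (use nn in blast)
qed

lemma epsilon_le_ratio:
  assumes X: "triangular_tp X" and "i < l"
  shows "epsilon X i \<le> X i l / X (i + 1) l"
  by (rule LIMSEQ_le_const2[OF epsilon_tendsto[OF X]])
    (use row_ratio_antimono[OF X \<open>i < l\<close>] in \<open>auto intro!: exI[of _ "nat l"]\<close>)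

text \<open>One step of the ASW factorization, multiplication by \<open>M(-\<epsilon>(X))\<close>, for matrices whose \<open>\<epsilon>\<close> need not
  be periodic.\<close>

definition asw_step :: "zmat \<Rightarrow> zmat" where
  "asw_step X i j = X i j - epsilon X i * X (i + 1) j"

lemma asw_step_nonneg:
  assumes "triangular_tp X" "i < j"
  shows "asw_step X i j \<ge> 0"
  using epsilon_le_ratio[OF assms] triangular_tp_entry_pos[OF assms(1), of "i + 1" j] assms(2)
  by (simp add: asw_step_def field_simps)

context curl_tails
begin

text \<open>The goal is an expansion of \<open>asw_step (T 0)\<close> as an infinite product of curls. The number
  \<open>eps m j - b (m + 1) j\<close> measures by how much the ASW parameter of \<open>T m\<close> exceeds the parameter of
  its first curl.\<close>

abbreviation eps where "eps m \<equiv> epsilon (T m)"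

definition excess where "excess m j = eps m j - b (Suc m) j"

lemma quotient_tendsto: "(\<lambda>l. T (Suc m) j (int l) / T m (j + 1) (int l)) \<longlonglongrightarrow> excess m j"
proof -
  have "(\<lambda>l. T m j (int l) / T m (j + 1) (int l) - b (Suc m) j) \<longlonglongrightarrow> excess m j"
    unfolding excess_def by (intro tendsto_diff tendsto_const epsilon_tendsto tp)
  moreover have "\<forall>\<^sub>F l in sequentially. T m j (int l) / T m (j + 1) (int l) - b (Suc m) j
      = T (Suc m) j (int l) / T m (j + 1) (int l)"
  proof (rule eventually_sequentiallyI[of "nat (j + 1)"])
    fix l assume "nat (j + 1) \<le> l"
    then have "T m (j + 1) (int l) > 0" by (intro triangular_tp_entry_pos[OF tp]) simp
    then show "T m j (int l) / T m (j + 1) (int l) - b (Suc m) j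
        = T (Suc m) j (int l) / T m (j + 1) (int l)"
      using rec[of m j "int l"] by (simp add: field_simps)
  qed
  ultimately show ?thesis by (rule Lim_transform_eventually)
qed

lemma excess_nonneg: "excess m j \<ge> 0"
  by (rule LIMSEQ_le_const[OF quotient_tendsto]) (use nonneg in auto)

lemma eps_ge: "b (Suc m) j \<le> eps m j"
  using excess_nonneg[of m j] by (simp add: excess_def)

lemma eps_pos: "eps m j > 0"
  using eps_ge[of m j] pos[of m j] by simp

text \<open>This is one of the two equations of \<open>M(-\<epsilon>(T\<^sub>m)) N(b) = N(b') M(-\<epsilon>(T\<^sub>m\<^sub>+\<^sub>1))\<close>; the other one serves
  as the definition of \<open>b'\<close>.\<close>

lemma eps_excess: "eps (Suc m) j * excess m (j + 1) = excess m j * eps m (j + 1)"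
proof -
  let ?q = "\<lambda>l. T (Suc m) j (int l) / T (Suc m) (j + 1) (int l)
      * (T (Suc m) (j + 1) (int l) / T m (j + 1 + 1) (int l))
      / (T m (j + 1) (int l) / T m (j + 1 + 1) (int l))"
  have "?q \<longlonglongrightarrow> eps (Suc m) j * excess m (j + 1) / eps m (j + 1)"
    using eps_pos[of m "j + 1"]
    by (intro tendsto_divide tendsto_mult epsilon_tendsto[OF tp] quotient_tendsto) simp
  moreover have "\<forall>\<^sub>F l in sequentially. ?q l = T (Suc m) j (int l) / T m (j + 1) (int l)"
  proof (rule eventually_sequentiallyI[of "nat (j + 2)"])
    fix l assume "nat (j + 2) \<le> l"
    then have "T (Suc m) (j + 1) (int l) > 0" "T m (j + 1 + 1) (int l) > 0"
      by (intro triangular_tp_entry_pos[OF tp]; simp)+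
    then show "?q l = T (Suc m) j (int l) / T m (j + 1) (int l)" by simp
  qed
  ultimately have "(\<lambda>l. T (Suc m) j (int l) / T m (j + 1) (int l))
      \<longlonglongrightarrow> eps (Suc m) j * excess m (j + 1) / eps m (j + 1)"
    by (rule Lim_transform_eventually)
  then have "excess m j = eps (Suc m) j * excess m (j + 1) / eps m (j + 1)"
    by (rule LIMSEQ_unique[OF quotient_tendsto])
  then show ?thesis using eps_pos[of m "j + 1"] by (simp add: field_simps)
qed

lemma excess_zero_everywhere: "excess m i = 0 \<Longrightarrow> excess m j = 0"
proof (induction j rule: int_induct[where k = i])
  case (step1 j)
  then show ?case using eps_excess[of m j] eps_pos[of "Suc m" j] by auto
next
  case (step2 j)
  then show ?case using eps_excess[of m "j - 1"] eps_pos[of m j] by auto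
qed auto

text \<open>By \<open>eps_excess\<close>, the excess vanishes at \<open>j\<close> if and only if it vanishes at \<open>j + 1\<close>.\<close>

lemma excess_dichotomy: "(\<forall>j. excess m j = 0) \<or> (\<forall>j. excess m j > 0)"
proof (cases "\<exists>j. excess m j = 0")
  case True
  then show ?thesis using excess_zero_everywhere by blast
next
  case False
  then show ?thesis using excess_nonneg by (metis order_less_le)
qed

text \<open>While the excess is positive, the whirl moves through the curls and changes their parameters. If
  the excess of \<open>T m\<close> vanishes, the ASW step cancels the first curl of \<open>T m\<close>, the whirl has
  disappeared, and the remaining curls are kept, with indices shifted by one.\<close>

definition exhausted where "exhausted m \<longleftrightarrow> (\<exists>m'\<le>m. \<forall>j. excess m' j = 0)"

text \<open>The value for index \<open>0\<close> is a dummy.\<close>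

definition new_param where
  "new_param m j = (case m of 0 \<Rightarrow> 0 | Suc m \<Rightarrow>
     if exhausted m then b (Suc (Suc m)) j else b (Suc m) j + eps (Suc m) j - eps m j)"

definition new_tail where "new_tail m = (if exhausted m then T (Suc m) else asw_step (T m))"

lemma exhausted_Suc: "exhausted (Suc m) \<longleftrightarrow> exhausted m \<or> (\<forall>j. excess (Suc m) j = 0)"
  by (auto simp: exhausted_def le_Suc_eq)

lemma asw_step_if_exhausted: "\<forall>j. excess m j = 0 \<Longrightarrow> asw_step (T m) = T (Suc m)"
proof (intro ext)
  fix i j assume "\<forall>j. excess m j = 0"
  then have "eps m i = b (Suc m) i" by (simp add: excess_def)
  then show "asw_step (T m) i j = T (Suc m) i j"
    using rec[of m i j] by (simp add: asw_step_def)
qed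

lemma new_tail_0: "new_tail 0 = asw_step (T 0)"
  using asw_step_if_exhausted[of 0] by (auto simp: new_tail_def exhausted_def)

lemma excess_pos: "\<not> exhausted m \<Longrightarrow> excess m j > 0"
  using excess_dichotomy[of m] by (auto simp: exhausted_def)

lemma new_param_pos: "new_param (Suc m) j > 0"
proof (cases "exhausted m")
  case False
  have "(eps (Suc m) j - excess m j) * excess m (j + 1) = excess m j * b (Suc m) (j + 1)"
    using eps_excess[of m j] by (simp add: excess_def algebra_simps)
  moreover have "excess m j * b (Suc m) (j + 1) > 0"
    using excess_pos[OF False] pos by simp
  ultimately have "(eps (Suc m) j - excess m j) * excess m (j + 1) > 0" by simp
  then have "eps (Suc m) j - excess m j > 0"
    using excess_pos[OF False, of "j + 1"] by (simp add: zero_less_mult_iff)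
  then show ?thesis using False by (simp add: new_param_def excess_def)
qed (simp add: new_param_def pos)

lemma new_tail_rec: "new_tail m i j = new_tail (Suc m) i j + new_param (Suc m) i * new_tail m (i + 1) j"
proof (cases "exhausted m")
  case True
  then show ?thesis using rec[of "Suc m" i j] by (simp add: new_tail_def new_param_def exhausted_Suc)
next
  case False
  have "new_tail (Suc m) = asw_step (T (Suc m))"
    using False asw_step_if_exhausted[of "Suc m"] by (auto simp: new_tail_def exhausted_Suc)
  moreover have "asw_step (T m) i j = asw_step (T (Suc m)) i j
      + (b (Suc m) i + eps (Suc m) i - eps m i) * asw_step (T m) (i + 1) j"
  proof -
    let ?x = "T m (i + 1) j" and ?y = "T m (i + 1 + 1) j" and ?\<beta> = "b (Suc m)"
    have T1: "T m i j = T (Suc m) i j + ?\<beta> i * ?x"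
      and T2: "T (Suc m) (i + 1) j = ?x - ?\<beta> (i + 1) * ?y"
      using rec[of m i j] rec[of m "i + 1" j] by simp_all
    \<comment> \<open>\<open>eps_excess\<close>, written with the parameters of the curl.\<close>
    have key: "eps (Suc m) i * (eps m (i + 1) - ?\<beta> (i + 1)) = (eps m i - ?\<beta> i) * eps m (i + 1)"
      using eps_excess[of m i] by (simp add: excess_def)
    have "asw_step (T (Suc m)) i j + (?\<beta> i + eps (Suc m) i - eps m i) * asw_step (T m) (i + 1) j
        = T (Suc m) i j + (?\<beta> i - eps m i) * ?x
          - (eps (Suc m) i * (eps m (i + 1) - ?\<beta> (i + 1)) - (eps m i - ?\<beta> i) * eps m (i + 1)) * ?y"
      unfolding asw_step_def T2 by (simp add: algebra_simps)
    also have "\<dots> = asw_step (T m) i j"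
      unfolding key asw_step_def T1 by (simp add: algebra_simps)
    finally show ?thesis by simp
  qed
  ultimately show ?thesis using False by (simp add: new_tail_def new_param_def)
qed

lemma new_tail_bounds: "0 \<le> new_tail m i j" "new_tail m i j \<le> T m i j + T (Suc m) i j" if "i < j"
proof -
  have "asw_step (T m) i j \<le> T m i j"
    using mult_nonneg_nonneg[OF epsilon_nonneg[OF tp] nonneg] by (simp add: asw_step_def)
  then have "asw_step (T m) i j \<le> T m i j + T (Suc m) i j" using nonneg[of "Suc m" i j] by simp
  then show "new_tail m i j \<le> T m i j + T (Suc m) i j"
    using nonneg[of m i j] by (simp add: new_tail_def)
  show "0 \<le> new_tail m i j" using asw_step_nonneg[OF tp that] nonneg by (simp add: new_tail_def)
qed

lemma new_tail_lower: "j < i \<Longrightarrow> new_tail m i j = 0"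
  by (simp add: new_tail_def asw_step_def lower)

lemma new_tail_diag: "new_tail m i i = 1"
  by (simp add: new_tail_def asw_step_def lower diag)

lemma curl_tails_new_tail: "curl_tails new_param new_tail"
proof
  show "new_tail m i j \<ge> 0" for m i j
    using new_tail_lower[of j i m] new_tail_diag[of m i] new_tail_bounds(1)[of i j m] by (cases i j rule: linorder_cases) auto
  show "(\<lambda>m. new_tail m i j) \<longlonglongrightarrow> 0" if "i < j" for i j
  proof (rule tendsto_sandwich[of "\<lambda>_. 0" _ _ "\<lambda>m. T m i j + T (Suc m) i j"])
    show "(\<lambda>m. T m i j + T (Suc m) i j) \<longlonglongrightarrow> 0"
      using tendsto_add[OF vanish[OF that] LIMSEQ_Suc[OF vanish[OF that]]] by simp
  qed (use new_tail_bounds[OF that] in auto)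
qed (rule new_param_pos new_tail_rec new_tail_lower new_tail_diag | assumption)+

text \<open>The new parameters telescope until the whirl disappears.\<close>

lemma sum_new_param_eq:
  "eps 0 j + (\<Sum>i=1..k. new_param i j) = (\<Sum>i=1..k. b i j) + (if exhausted k then b (Suc k) j else eps k j)"
proof (induction k)
  case 0
  then show ?case by (auto simp: exhausted_def excess_def)
next
  case (Suc k)
  have "(\<forall>j. excess (Suc k) j = 0) \<Longrightarrow> eps (Suc k) j = b (Suc (Suc k)) j" by (simp add: excess_def)
  then show ?case using Suc by (auto simp: new_param_def exhausted_Suc)
qed

lemma sum_new_param_ge: "(\<Sum>i=1..Suc k. b i j) \<le> eps 0 j + (\<Sum>i=1..k. new_param i j)"
  unfolding sum_new_param_eq using eps_ge[of k j] by simp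

end

primrec asw_iter :: "zmat \<Rightarrow> nat \<Rightarrow> zmat" where
  "asw_iter X 0 = X"
| "asw_iter X (Suc m) = asw_step (asw_iter X m)"

text \<open>After \<open>m\<close> steps the rest is still a product of curls, and the \<open>m\<close> extracted parameters together
  with the first \<open>k\<close> parameters of the rest dominate the first \<open>m + k\<close> original ones.\<close>

lemma asw_iter_tails:
  assumes "curl_tails b T" "T 0 = X"
  shows "\<exists>\<beta> R. curl_tails \<beta> R \<and> R 0 = asw_iter X m
    \<and> (\<forall>k j. (\<Sum>i=1..m + k. b i j) \<le> (\<Sum>i=1..m. epsilon (asw_iter X (i - 1)) j) + (\<Sum>i=1..k. \<beta> i j))"
proof (induction m)
  case 0
  show ?case using assms by (intro exI[of _ b] exI[of _ T]) simp
next
  case (Suc m)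
  then obtain \<beta> R where R: "curl_tails \<beta> R" "R 0 = asw_iter X m"
    and le: "\<And>k j. (\<Sum>i=1..m + k. b i j)
        \<le> (\<Sum>i=1..m. epsilon (asw_iter X (i - 1)) j) + (\<Sum>i=1..k. \<beta> i j)" by blast
  interpret R: curl_tails \<beta> R by (rule R(1))
  have "(\<Sum>i=1..Suc m + k. b i j) \<le> (\<Sum>i=1..Suc m. epsilon (asw_iter X (i - 1)) j) + (\<Sum>i=1..k. R.new_param i j)"
    for k j
    using le[where k = "Suc k" and j = j] R.sum_new_param_ge[of j k] R(2) by simp
  then show ?case
    using R.curl_tails_new_tail R.new_tail_0 R(2) by (intro exI[of _ R.new_param] exI[of _ R.new_tail]) simp
qed

text \<open>The superdiagonal entry of \<open>X\<^sub>m\<^sub>+\<^sub>1\<close> is that of \<open>X\<close> minus the extracted parameters, hence bounded by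
  that of the \<open>m\<close>-th tail of the given expansion, which tends to \<open>0\<close>. The other entries follow
  because ratios of neighbouring rows decrease.\<close>

theorem curl_tails_asw:
  assumes "curl_tails b T" "T 0 = X"
  shows "curl_tails (\<lambda>m. epsilon (asw_iter X (m - 1))) (asw_iter X)"
proof -
  let ?A = "asw_iter X" and ?a = "\<lambda>m. epsilon (asw_iter X (m - 1))"
  interpret T: curl_tails b T by (rule assms(1))
  have tails: "\<exists>\<beta> R. curl_tails \<beta> R \<and> R 0 = ?A m" for m using asw_iter_tails[OF assms] by blast
  have A_tp: "triangular_tp (?A m)" for m using tails[of m] curl_tails.tp by metis
  have A_low: "?A m i j = 0" if "j < i" for m i j using tails[of m] curl_tails.lower that by metis
  have A_diag: "?A m i i = 1" for m i using tails[of m] curl_tails.diag by metis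
  have A_nn: "?A m i j \<ge> 0" for m i j using tails[of m] curl_tails.nonneg by metis
  have A_rec: "?A m i j = ?A (Suc m) i j + ?a (Suc m) i * ?A m (i + 1) j" for m i j
    by (simp add: asw_step_def)
  have near: "(\<lambda>m. ?A m i (i + 1)) \<longlonglongrightarrow> 0" for i
  proof (rule tendsto_sandwich[of "\<lambda>_. 0" _ _ "\<lambda>m. T m i (i + 1)"])
    have "?A m i (i + 1) = X i (i + 1) - (\<Sum>r=1..m. ?a r i)" for m
      using A_diag by (induction m) (simp_all add: asw_step_def)
    moreover have "T m i (i + 1) = X i (i + 1) - (\<Sum>r=1..m. b r i)" for m
    proof (induction m)
      case (Suc m)
      then show ?case using T.rec[of m i "i + 1"] by (simp add: T.diag)
    qed (simp add: assms(2))
    moreover have "(\<Sum>r=1..m. b r i) \<le> (\<Sum>r=1..m. ?a r i)" for m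
    proof -
      obtain \<beta> where "\<And>k j. (\<Sum>r=1..m + k. b r j) \<le> (\<Sum>r=1..m. ?a r j) + (\<Sum>r=1..k. \<beta> r j)"
        using asw_iter_tails[OF assms, of m] by blast
      from this[where k = 0] show ?thesis by simp
    qed
    ultimately show "\<forall>\<^sub>F m in sequentially. ?A m i (i + 1) \<le> T m i (i + 1)" by simp
  qed (use A_nn T.vanish in auto)
  have A_le: "?A m i j \<le> X i j" for m i j
  proof (induction m)
    case (Suc m)
    have "?A (Suc m) i j \<le> ?A m i j"
      using mult_nonneg_nonneg[OF epsilon_nonneg[OF A_tp] A_nn] by (simp add: asw_step_def)
    then show ?case using Suc by simp
  qed simp
  show ?thesis
  proof
    show "?a (Suc m) j > 0" for m j
    proof -
      obtain \<beta> R where "curl_tails \<beta> R" "R 0 = ?A m" using tails by blast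
      then show ?thesis using curl_tails.eps_pos[of \<beta> R 0 j] by simp
    qed
    show "(\<lambda>m. ?A m i j) \<longlonglongrightarrow> 0" if "i < j" for i j
    proof (rule tendsto_sandwich[of "\<lambda>_. 0" _ _ "\<lambda>m. ?A m i (i + 1) * X (i + 1) j"])
      have "?A m i j \<le> ?A m i (i + 1) * X (i + 1) j" for m
      proof -
        have "?A m i j / ?A m (i + 1) j \<le> ?A m i (i + 1)"
          using row_ratio_antimono[OF A_tp, of i "i + 1" j m] that by (simp add: A_diag)
        then have "?A m i j \<le> ?A m i (i + 1) * ?A m (i + 1) j"
          using triangular_tp_entry_pos[OF A_tp, of "i + 1" j m] that by (simp add: field_simps)
        also have "\<dots> \<le> ?A m i (i + 1) * X (i + 1) j" by (intro mult_left_mono A_le A_nn)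
        finally show ?thesis .
      qed
      then show "\<forall>\<^sub>F m in sequentially. ?A m i j \<le> ?A m i (i + 1) * X (i + 1) j" by simp
      show "(\<lambda>m. ?A m i (i + 1) * X (i + 1) j) \<longlonglongrightarrow> 0"
        using tendsto_mult_right[OF near[of i], of "X (i + 1) j"] by simp
    qed (use A_nn in auto)
  qed (rule A_low A_diag A_nn A_rec | assumption)+
qed

section \<open>Quotients of minors in the limit\<close>

locale asw_tails = curl_tails +
  assumes epsilon_eq: "epsilon (T m) j = b (Suc m) j"
begin

lemma row_ratio_tendsto:
  assumes "t \<le> r"
  shows "(\<lambda>l. T m t (int l) / T m r (int l)) \<longlonglongrightarrow> gcurl (b (Suc m)) t r"
  using assms
proof (induction t rule: int_le_induct)
  case base
  have "\<forall>\<^sub>F l in sequentially. 1 = T m r (int l) / T m r (int l)"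
  proof (rule eventually_sequentiallyI[of "nat r"])
    fix l assume "nat r \<le> l"
    then have "T m r (int l) > 0" by (intro triangular_tp_entry_pos[OF tp]) simp
    then show "1 = T m r (int l) / T m r (int l)" by simp
  qed
  then have "(\<lambda>l. T m r (int l) / T m r (int l)) \<longlonglongrightarrow> 1"
    by (rule Lim_transform_eventually[OF tendsto_const])
  moreover have "gcurl (b (Suc m)) r r = 1" by (simp add: gcurl_def)
  ultimately show ?case by (simp only:)
next
  case (step t)
  have "(\<lambda>l. T m (t - 1) (int l) / T m t (int l) * (T m t (int l) / T m r (int l)))
      \<longlonglongrightarrow> b (Suc m) (t - 1) * gcurl (b (Suc m)) t r"
    using epsilon_tendsto[OF tp, of m "t - 1"] step.IH by (intro tendsto_mult) (simp_all add: epsilon_eq)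
  moreover have "b (Suc m) (t - 1) * gcurl (b (Suc m)) t r = gcurl (b (Suc m)) (t - 1) r"
  proof -
    have "{t - 1..<r} = insert (t - 1) {t..<r}" using step by auto
    then show ?thesis using step by (simp add: gcurl_def)
  qed
  moreover have "\<forall>\<^sub>F l in sequentially. T m (t - 1) (int l) / T m t (int l) * (T m t (int l) / T m r (int l))
      = T m (t - 1) (int l) / T m r (int l)"
  proof (rule eventually_sequentiallyI[of "nat t"])
    fix l assume "nat t \<le> l"
    then have "T m t (int l) > 0" by (intro triangular_tp_entry_pos[OF tp]) simp
    then show "T m (t - 1) (int l) / T m t (int l) * (T m t (int l) / T m r (int l))
      = T m (t - 1) (int l) / T m r (int l)" by simp
  qed
  ultimately show ?case using Lim_transform_eventually by fastforce
qed

end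

text \<open>On the rows up to \<open>r\<close>, all columns \<open>t > r - s\<close> of \<open>P\<^sub>s\<close> are spanned by the \<open>s\<close> columns \<open>r - m\<close> of
  \<open>P\<^sub>m\<^sub>+\<^sub>1\<close>, \<open>m < s\<close>. The statement is dual: a linear functional, with coefficients \<open>\<kappa>\<close>, that
  vanishes on the latter vanishes on the former.\<close>

lemma functional_vanishes_beyond_frame:
  fixes f :: "nat \<Rightarrow> int"
  assumes f: "\<And>p. p < k \<Longrightarrow> f p \<le> r"
    and frame: "\<And>m. m < s \<Longrightarrow> (\<Sum>p<k. \<kappa> p * gprod b (Suc m) (f p) (r - int m)) = 0"
    and t: "r - int s < t"
  shows "(\<Sum>p<k. \<kappa> p * gprod b s (f p) t) = 0"
  using frame t
proof (induction s arbitrary: t)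
  case 0
  then show ?case using f by (intro sum.neutral) (fastforce simp: zmat_one_def)
next
  case (Suc s)
  have "r - int s \<le> t" using Suc.prems(2) by simp
  then show ?case
  proof (induction t rule: int_ge_induct)
    case base
    show ?case by (rule Suc.prems(1)) simp
  next
    case (step t)
    have "(\<Sum>p<k. \<kappa> p * gprod b s (f p) (t + 1)) = 0"
      by (rule Suc.IH) (use Suc.prems(1) step.hyps in auto)
    moreover have "(\<Sum>p<k. \<kappa> p * gprod b (Suc s) (f p) (t + 1))
        = (\<Sum>p<k. \<kappa> p * gprod b s (f p) (t + 1)) + b (Suc s) t * (\<Sum>p<k. \<kappa> p * gprod b (Suc s) (f p) t)"
      unfolding sum_distrib_left sum.distrib[symmetric]
    proof (rule sum.cong[OF refl])
      fix p
      have "gprod b (Suc s) (f p) (t + 1) = gprod b s (f p) (t + 1) + b (Suc s) t * gprod b (Suc s) (f p) t"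
        using gprod_Suc[of b s "f p" "t + 1"] by (simp del: gprod.simps)
      then show "\<kappa> p * gprod b (Suc s) (f p) (t + 1)
          = \<kappa> p * gprod b s (f p) (t + 1) + b (Suc s) t * (\<kappa> p * gprod b (Suc s) (f p) t)"
        by (simp only: distrib_left mult.left_commute)
    qed
    ultimately show ?case using step.IH by (simp only: mult_zero_right add_0)
  qed
qed

context asw_tails
begin

text \<open>The determinant after the last \<open>s\<close> columns have been sent to infinity. Column \<open>q\<close> has become
  column \<open>i + 1 + q\<close> of \<open>P\<^sub>k\<^sub>-\<^sub>q\<close>: the last column, which was the first one to go, feels only the
  first curl.\<close>

definition frame_det :: "nat \<Rightarrow> int \<Rightarrow> (nat \<Rightarrow> int) \<Rightarrow> nat \<Rightarrow> (nat \<Rightarrow> int) \<Rightarrow> real" where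
  "frame_det k i f s g = vdet k (\<lambda>q p. if q < k - s then T 0 (f p) (g q)
     else gprod b (k - q) (f p) (i + 1 + int q))"

lemma frame_det_0: "frame_det k i f 0 g = pminor k (T 0) f g"
proof -
  have "frame_det k i f 0 g = vdet k (\<lambda>q p. T 0 (f p) (g q))"
    unfolding frame_det_def by (rule vdet_cong) simp
  also have "\<dots> = pminor k (T 0) f g" unfolding pminor_def by (rule vdet_transpose)
  finally show ?thesis .
qed

text \<open>Let \<open>\<Lambda>\<close> be the determinant as a linear functional of the column that goes to infinity. Expanding
  \<open>X = P\<^sub>s X\<^sub>s\<^sub>+\<^sub>1\<close>, its value at column \<open>l\<close> of \<open>X\<close> is a sum over \<open>t \<le> l\<close> of \<open>\<Lambda>\<close> at column \<open>t\<close> of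
  \<open>P\<^sub>s\<close> times \<open>X\<^sub>s\<^sub>+\<^sub>1 t l\<close>. Only finitely many \<open>t\<close>, independent of \<open>l\<close>, contribute, because \<open>\<Lambda>\<close>
  vanishes beyond the columns replaced so far. The quotients of rows of \<open>X\<^sub>s\<^sub>+\<^sub>1\<close> converge to the
  entries of the next curl, which turns column sums of \<open>P\<^sub>s\<close> into a column of \<open>P\<^sub>s\<^sub>+\<^sub>1\<close>.\<close>

lemma frame_det_limit:
  assumes s: "s < k" and f: "\<And>p. p < k \<Longrightarrow> f p \<le> i + int k"
  shows "(\<lambda>l. frame_det k i f s (g(k - Suc s := int l)) / T s (i + int (k - s)) (int l))
    \<longlonglongrightarrow> frame_det k i f (Suc s) g"
proof -
  define q0 where "q0 = k - Suc s"
  define r where "r = i + int (k - s)"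
  let ?h = "\<lambda>q p. if q < k - s then T 0 (f p) (g q) else gprod b (k - q) (f p) (i + 1 + int q)"
  have q0: "q0 < k" "k - s = Suc q0" "k - q0 = Suc s" "i + 1 + int q0 = r"
    using s by (auto simp: q0_def r_def)
  obtain \<kappa> where \<kappa>: "\<And>v. vdet k (?h(q0 := v)) = (\<Sum>p<k. \<kappa> p * v p)"
    using vdet_row_functional[OF q0(1)] by blast
  define \<Lambda> where "\<Lambda> t = (\<Sum>p<k. \<kappa> p * gprod b s (f p) t)" for t
  \<comment> \<open>Replacing the moving column by one of the frame columns gives two equal columns.\<close>
  have zero: "\<Lambda> t = 0" if "r < t" for t
    unfolding \<Lambda>_def
  proof (rule functional_vanishes_beyond_frame[where r = "i + int k"])
    show "f p \<le> i + int k" if "p < k" for p by (rule f[OF that])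
    show "i + int k - int s < t" using that s by (simp add: r_def of_nat_diff)
    show "(\<Sum>p<k. \<kappa> p * gprod b (Suc m) (f p) (i + int k - int m)) = 0" if "m < s" for m
    proof -
      have m: "k - Suc m < k" "k - (k - Suc m) = Suc m" "\<not> k - Suc m < k - s" "k - Suc m \<noteq> q0"
        "i + 1 + int (k - Suc m) = i + int k - int m"
        using that s q0 by (auto simp: of_nat_diff)
      have "vdet k (?h(q0 := ?h (k - Suc m))) = 0"
        by (rule vdet_equal_rows[of q0 _ "k - Suc m"]) (use q0 m in auto)
      then show ?thesis by (simp only: \<kappa> m if_False)
    qed
  qed
  \<comment> \<open>A common lower limit of summation for all rows; the terms below the diagonal are zero.\<close>
  obtain m0 where m0: "\<And>p. p < k \<Longrightarrow> m0 \<le> f p" "m0 \<le> r"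
  proof -
    let ?m = "Min (insert r (f ` {..<k}))"
    show thesis by (rule that[of ?m]) auto
  qed
  have extend: "(\<Sum>t\<in>{m0..l}. gprod b s (f p) t * h t) = (\<Sum>t\<in>{f p..l}. gprod b s (f p) t * h t)"
    if "p < k" for p l and h :: "int \<Rightarrow> real"
    by (rule sum.mono_neutral_right) (use m0(1)[OF that] gprod_lower in auto)
  have at_l: "frame_det k i f s (g(q0 := l)) = (\<Sum>t\<in>{m0..r}. \<Lambda> t * T s t l)" if "r \<le> l" for l
  proof -
    have "frame_det k i f s (g(q0 := l)) = vdet k (?h(q0 := \<lambda>p. T 0 (f p) l))"
      unfolding frame_det_def by (rule vdet_cong) (use q0 in auto)
    also have "\<dots> = (\<Sum>p<k. \<kappa> p * (\<Sum>t\<in>{m0..l}. gprod b s (f p) t * T s t l))"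
      unfolding \<kappa> by (intro sum.cong refl) (simp add: extend factor[of _ _ s])
    also have "\<dots> = (\<Sum>t\<in>{m0..l}. \<Lambda> t * T s t l)"
      unfolding \<Lambda>_def sum_distrib_left sum_distrib_right by (subst sum.swap) (simp add: mult.assoc)
    also have "\<dots> = (\<Sum>t\<in>{m0..r}. \<Lambda> t * T s t l)"
      by (rule sum.mono_neutral_right) (use that zero in auto)
    finally show ?thesis .
  qed
  have "(\<lambda>l. \<Sum>t\<in>{m0..r}. \<Lambda> t * (T s t (int l) / T s r (int l)))
      \<longlonglongrightarrow> (\<Sum>t\<in>{m0..r}. \<Lambda> t * gcurl (b (Suc s)) t r)"
    by (intro tendsto_sum tendsto_mult tendsto_const row_ratio_tendsto) simp
  moreover have "\<forall>\<^sub>F l in sequentially. (\<Sum>t\<in>{m0..r}. \<Lambda> t * (T s t (int l) / T s r (int l)))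
      = frame_det k i f s (g(q0 := int l)) / T s r (int l)"
    by (rule eventually_sequentiallyI[of "nat r"]) (simp add: at_l sum_divide_distrib)
  moreover have "(\<Sum>t\<in>{m0..r}. \<Lambda> t * gcurl (b (Suc s)) t r) = frame_det k i f (Suc s) g"
  proof -
    have "(\<Sum>t\<in>{m0..r}. \<Lambda> t * gcurl (b (Suc s)) t r)
        = (\<Sum>p<k. \<kappa> p * (\<Sum>t\<in>{m0..r}. gprod b s (f p) t * gcurl (b (Suc s)) t r))"
      unfolding \<Lambda>_def sum_distrib_left sum_distrib_right by (subst sum.swap) (simp add: mult.assoc)
    also have "\<dots> = (\<Sum>p<k. \<kappa> p * gprod b (Suc s) (f p) r)"
      by (intro sum.cong refl) (simp add: extend zmat_mult_def)
    also have "\<dots> = vdet k (?h(q0 := \<lambda>p. gprod b (Suc s) (f p) r))" unfolding \<kappa> ..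
    also have "\<dots> = frame_det k i f (Suc s) g"
      unfolding frame_det_def by (rule vdet_cong) (use q0 in \<open>auto simp: less_Suc_eq simp del: gprod.simps\<close>)
    finally show ?thesis .
  qed
  ultimately show ?thesis
    unfolding q0_def[symmetric] r_def[symmetric] using Lim_transform_eventually by fastforce
qed

text \<open>Linear inequalities between minors survive the iterated limit. Working with inequalities instead
  of quotients avoids a proof that the intermediate denominators are positive.\<close>

lemma frame_det_inequality:
  assumes f: "\<And>p. p < k \<Longrightarrow> f p \<le> i + int k" "\<And>p. p < k \<Longrightarrow> f' p \<le> i + int k"
    and ineq: "\<And>g. strict_mono_on {..<k} g \<Longrightarrow> (\<And>q. q < k \<Longrightarrow> N \<le> g q)
      \<Longrightarrow> \<alpha> * pminor k (T 0) f g \<le> \<beta> * pminor k (T 0) f' g"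
    and s: "s \<le> k" and g: "strict_mono_on {..<k - s} g" "\<And>q. q < k - s \<Longrightarrow> N \<le> g q"
  shows "\<alpha> * frame_det k i f s g \<le> \<beta> * frame_det k i f' s g"
  using s g
proof (induction s arbitrary: g)
  case 0
  then show ?case unfolding frame_det_0 by (intro ineq) auto
next
  case (Suc s)
  let ?q = "k - Suc s" and ?r = "i + int (k - s)"
  have k: "k - s = Suc ?q" "s < k" using Suc.prems(1) by auto
  let ?F = "\<lambda>f l. frame_det k i f s (g(?q := int l)) / T s ?r (int l)"
  have lim: "(\<lambda>l. \<alpha> * ?F f l) \<longlonglongrightarrow> \<alpha> * frame_det k i f (Suc s) g"
    "(\<lambda>l. \<beta> * ?F f' l) \<longlonglongrightarrow> \<beta> * frame_det k i f' (Suc s) g"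
    using k f by (intro tendsto_mult tendsto_const frame_det_limit; simp)+
  define B where "B = Max (insert N (insert ?r (g ` {..<?q})))"
  have B: "N \<le> B" "?r \<le> B" "q < ?q \<Longrightarrow> g q \<le> B" for q
    unfolding B_def by (rule Max_ge; force)+
  have "\<alpha> * ?F f l \<le> \<beta> * ?F f' l" if "nat (B + 1) \<le> l" for l
  proof -
    have l: "B < int l" using that by linarith
    have mono: "strict_mono_on {..<k - s} (g(?q := int l))"
    proof (rule strict_mono_onI)
      fix p q assume pq: "p \<in> {..<k - s}" "q \<in> {..<k - s}" "p < q"
      then show "(g(?q := int l)) p < (g(?q := int l)) q"
        using Suc.prems(2) B(3)[of p] l k by (auto simp: strict_mono_on_def less_Suc_eq)
    qed
    have "\<alpha> * frame_det k i f s (g(?q := int l)) \<le> \<beta> * frame_det k i f' s (g(?q := int l))"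
      by (rule Suc.IH[OF _ mono]) (use Suc.prems(3) B(1) l k in \<open>auto simp: less_Suc_eq\<close>)
    moreover have "T s ?r (int l) > 0" using B(2) l by (intro triangular_tp_entry_pos[OF tp]) simp
    ultimately show ?thesis by (simp add: divide_right_mono)
  qed
  then show ?case by (intro LIMSEQ_le[OF lim]) blast
qed

text \<open>When all columns have been replaced, column operations raise every \<open>P\<^sub>k\<^sub>-\<^sub>q\<close> to \<open>P\<^sub>k\<close>, one level at a
  time.\<close>

lemma frame_det_full: "frame_det k i f k g = pminor k (gprod b k) f (\<lambda>q. i + 1 + int q)"
proof -
  let ?D = "\<lambda>v. vdet k (\<lambda>q p. gprod b (max (k - q) v) (f p) (i + 1 + int q))"
  have "?D v = ?D 0" if "v \<le> k" for v
    using that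
  proof (induction v)
    case (Suc v)
    have "?D (Suc v) = ?D v"
    proof (rule vdet_bidiagonal[where x = "\<lambda>s. if k - s \<le> v then b (Suc v) (i + int s) else 0"])
      fix s q assume s: "s < k"
      show "gprod b (max (k - s) (Suc v)) (f q) (i + 1 + int s)
        = gprod b (max (k - s) v) (f q) (i + 1 + int s)
          + (if k - s \<le> v then b (Suc v) (i + int s) else 0)
            * gprod b (max (k - (s - 1)) (Suc v)) (f q) (i + 1 + int (s - 1))"
      proof (cases "k - s \<le> v")
        case True
        then have lev: "max (k - s) (Suc v) = Suc v" "max (k - s) v = v"
          "max (k - (s - 1)) (Suc v) = Suc v" "i + 1 + int (s - 1) = i + int s"
          using s Suc.prems by auto
        show ?thesis
          unfolding lev using True gprod_Suc[of b v "f q" "i + 1 + int s"]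
          by (simp add: add.commute add.left_commute del: gprod.simps)
      next
        case False
        then have "max (k - s) (Suc v) = max (k - s) v" by simp
        then show ?thesis using False by simp
      qed
    qed (use Suc.prems in auto)
    then show ?case using Suc by simp
  qed simp
  from this[of k] have "?D k = ?D 0" by simp
  moreover have "?D 0 = frame_det k i f k g"
    unfolding frame_det_def by (rule vdet_cong) simp
  moreover have "?D k = vdet k (\<lambda>q p. gprod b k (f p) (i + 1 + int q))"
    by (rule vdet_cong) simp
  moreover have "\<dots> = pminor k (gprod b k) f (\<lambda>q. i + 1 + int q)"
    unfolding pminor_def by (rule vdet_transpose)
  ultimately show ?thesis by simp
qed

lemma pminor_gprod_block: "pminor k (gprod b m) (\<lambda>q. i + 1 + int q) (\<lambda>q. i + 1 + int q) = 1"
  unfolding pminor_def by (rule vdet_upper_unitriangular) (simp_all add: gprod_lower gprod_diag)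

theorem minor_ratio_tendsto:
  fixes f :: "nat \<Rightarrow> int"
  assumes k: "k \<ge> 1" and f: "strict_mono_on {..<k} f" "\<And>p. p < k \<Longrightarrow> f p \<le> i + 1 + int p"
  defines "block \<equiv> \<lambda>h q. h + 1 + int q"
  shows "(\<lambda>h. pminor k (T 0) f (block (int h)) / pminor k (T 0) (block i) (block (int h)))
    \<longlonglongrightarrow> pminor k (gprod b k) f (block i)"
proof -
  let ?D = "pminor k (gprod b k) f (block i)" and ?N = "i + int k"
  let ?P = "pminor k (T 0)"
  let ?R = "\<lambda>g. ?P f g / ?P (block i) g"
  have block_mono: "strict_mono_on {..<k} (block h)" for h by (auto simp: block_def strict_mono_on_def)
  have f_le: "f p \<le> block i p" if "p < k" for p using f(2)[OF that] by (simp add: block_def)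
  have block_N: "block i p \<le> ?N" if "p < k" for p using that by (simp add: block_def)
  have f_N: "f p \<le> ?N" if "p < k" for p using f_le[OF that] block_N[OF that] by simp
  have pos: "?P (block i) g > 0" if "strict_mono_on {..<k} g" "\<And>q. q < k \<Longrightarrow> ?N \<le> g q" for g
    by (rule triangular_tpD[OF tp block_mono that(1)]) (meson block_N order_trans that(2))
  have ratio_le: "?R g' \<le> ?R g"
    if "strict_mono_on {..<k} g" "strict_mono_on {..<k} g'" "\<And>q. q < k \<Longrightarrow> g q \<le> g' q"
      "\<And>q. q < k \<Longrightarrow> ?N \<le> g q" for g g'
    by (rule minor_ratio_antimono[OF tp f(1) block_mono f_le that(1-3) block_N that(4)])
  have full: "frame_det k i f k g = ?D" "frame_det k i (block i) k g = 1" for g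
    unfolding frame_det_full block_def by (simp_all add: pminor_gprod_block)
  \<comment> \<open>All increasing column sequences from \<open>h + 1\<close> on lie to the right of the block at \<open>h\<close>.\<close>
  have lower: "?D \<le> ?R (block (int h))" if h: "?N \<le> int h + 1" for h
  proof -
    have ineq: "1 * ?P f g \<le> ?R (block (int h)) * ?P (block i) g"
      if g: "strict_mono_on {..<k} g" "\<And>q. q < k \<Longrightarrow> int h + 1 \<le> g q" for g
    proof -
      have "block (int h) q \<le> g q" if "q < k" for q
        using strict_mono_diff_le[OF g(1), of 0 q] g(2)[of 0] that by (simp add: block_def)
      then have "?R g \<le> ?R (block (int h))"
        by (intro ratio_le block_mono g) (use h in \<open>auto simp: block_def\<close>)
      moreover have "?P (block i) g > 0" using g h by (intro pos) force+
      ultimately show ?thesis by (simp add: field_simps)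
    qed
    have "1 * frame_det k i f k (\<lambda>_. 0) \<le> ?R (block (int h)) * frame_det k i (block i) k (\<lambda>_. 0)"
      by (rule frame_det_inequality[OF f_N block_N ineq]) (simp_all add: strict_mono_on_def)
    then show ?thesis by (simp only: full mult_1 mult_1_right)
  qed
  \<comment> \<open>If no fixed columns gave a quotient below \<open>?D + e\<close>, the iterated limit \<open>?D\<close> would be at least \<open>?D + e\<close>.\<close>
  have upper: "\<forall>\<^sub>F h in sequentially. ?R (block (int h)) < ?D + e" if "e > 0" for e
  proof -
    have "\<exists>g. strict_mono_on {..<k} g \<and> (\<forall>q<k. ?N \<le> g q) \<and> ?P f g < (?D + e) * ?P (block i) g"
    proof (rule ccontr)
      assume "\<not> ?thesis"
      then have ineq: "(?D + e) * ?P (block i) g \<le> 1 * ?P f g"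
        if "strict_mono_on {..<k} g" "\<And>q. q < k \<Longrightarrow> ?N \<le> g q" for g
        using that by (auto simp: not_less)
      have "(?D + e) * frame_det k i (block i) k (\<lambda>_. 0) \<le> 1 * frame_det k i f k (\<lambda>_. 0)"
        by (rule frame_det_inequality[OF block_N f_N ineq]) (simp_all add: strict_mono_on_def)
      then show False using \<open>e > 0\<close> by (simp only: full mult_1 mult_1_right)
    qed
    then obtain g where g: "strict_mono_on {..<k} g" "\<And>q. q < k \<Longrightarrow> ?N \<le> g q"
      and less: "?P f g < (?D + e) * ?P (block i) g" by blast
    have "?R g < ?D + e" using less pos[OF g] by (simp add: divide_less_eq)
    moreover have "?R (block (int h)) \<le> ?R g" if h: "nat (g (k - 1)) \<le> h" for h
    proof (rule ratio_le[OF g(1) block_mono _ g(2)])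
      fix q assume q: "q < k"
      then have "g q \<le> g (k - 1)"
        using g(1) by (cases "q = k - 1") (auto simp: strict_mono_on_def less_imp_le)
      then show "g q \<le> block (int h) q" using h by (simp add: block_def)
    qed
    ultimately show ?thesis
      by (intro eventually_sequentiallyI[of "nat (g (k - 1))"]) force
  qed
  show ?thesis
  proof (rule order_tendstoI)
    fix y assume "y < ?D"
    then show "\<forall>\<^sub>F h in sequentially. y < ?R (block (int h))"
      using lower by (intro eventually_sequentiallyI[of "nat ?N"]) (force intro: less_le_trans)
  next
    fix y assume "?D < y"
    then show "\<forall>\<^sub>F h in sequentially. ?R (block (int h)) < y"
      using upper[of "y - ?D"] by simp
  qed
qed

end

section \<open>Loop Schur functions\<close>

definition shift_invariant :: "nat \<Rightarrow> zmat \<Rightarrow> bool" where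
  "shift_invariant n X \<longleftrightarrow> (\<forall>i j. X (i + int n) (j + int n) = X i j)"

lemma curl_eq_gcurl: "curl n a = gcurl (\<lambda>t. a (t mod int n))"
  by (simp add: fun_eq_iff curl_def gcurl_def)

lemma curl_prod_eq_gprod: "curl_prod n b m = gprod (\<lambda>m t. b m (t mod int n)) m"
  by (induction m) (simp_all add: curl_eq_gcurl)

lemma shift_invariant_gprod:
  assumes "\<And>m j. b m (j + int n) = b m j"
  shows "shift_invariant n (gprod b m)"
proof (induction m)
  case 0
  show ?case by (simp add: shift_invariant_def zmat_one_def)
next
  case (Suc m)
  have curl: "gcurl (b (Suc m)) (i + int n) (j + int n) = gcurl (b (Suc m)) i j" for i j
  proof (cases "i \<le> j")
    case True
    have "(\<Prod>t\<in>{i + int n..<j + int n}. b (Suc m) t) = (\<Prod>t\<in>{i..<j}. b (Suc m) t)"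
      by (rule prod.reindex_bij_witness[where i = "\<lambda>t. t + int n" and j = "\<lambda>t. t - int n"])
        (use assms[of "Suc m" "t - int n" for t] in auto)
    then show ?thesis by (simp add: gcurl_def)
  qed (simp add: gcurl_def)
  have "(\<Sum>t\<in>{i + int n..j + int n}. gprod b m (i + int n) t * gcurl (b (Suc m)) t (j + int n))
      = (\<Sum>t\<in>{i..j}. gprod b m i t * gcurl (b (Suc m)) t j)" for i j
  proof (rule sum.reindex_bij_witness[where i = "\<lambda>t. t + int n" and j = "\<lambda>t. t - int n"])
    fix t assume "t \<in> {i + int n..j + int n}"
    show "gprod b m i (t - int n) * gcurl (b (Suc m)) (t - int n) j
        = gprod b m (i + int n) t * gcurl (b (Suc m)) t (j + int n)"
      using Suc curl[of "t - int n" j] unfolding shift_invariant_def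
      by (metis diff_add_cancel)
  qed auto
  then show ?case by (simp add: shift_invariant_def zmat_mult_def)
qed

lemma shift_invariant_epsilon:
  assumes X: "triangular_tp X" and n: "shift_invariant n X"
  shows "epsilon X (j + int n) = epsilon X j"
proof -
  have "(\<lambda>l. X (j + int n) (int (l + n)) / X (j + int n + 1) (int (l + n))) \<longlonglongrightarrow> epsilon X (j + int n)"
    by (rule LIMSEQ_ignore_initial_segment[OF epsilon_tendsto[OF X]])
  moreover have "X (j + int n) (int (l + n)) / X (j + int n + 1) (int (l + n))
      = X j (int l) / X (j + 1) (int l)" for l
    using n[unfolded shift_invariant_def, rule_format, of j "int l"]
      n[unfolded shift_invariant_def, rule_format, of "j + 1" "int l"]
    by (simp add: add_ac)
  ultimately have "(\<lambda>l. X j (int l) / X (j + 1) (int l)) \<longlonglongrightarrow> epsilon X (j + int n)" by simp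
  then show ?thesis using epsilon_tendsto[OF X] by (rule LIMSEQ_unique)
qed

lemma shift_invariant_asw_step:
  assumes "triangular_tp X" and n: "shift_invariant n X"
  shows "shift_invariant n (asw_step X)"
  unfolding shift_invariant_def
proof (intro allI)
  fix i j
  have "X (i + int n) (j + int n) = X i j" "X (i + int n + 1) (j + int n) = X (i + 1) j"
    using n[unfolded shift_invariant_def, rule_format, of i j]
      n[unfolded shift_invariant_def, rule_format, of "i + 1" j] by (simp_all add: add_ac)
  then show "asw_step X (i + int n) (j + int n) = asw_step X i j"
    by (simp add: asw_step_def shift_invariant_epsilon[OF assms])
qed

lemma periodic_mod:
  fixes f :: "int \<Rightarrow> real"
  assumes "\<And>j. f (j + int n) = f j"
  shows "f (j mod int n) = f j"
proof -
  have "f (r + int n * q) = f r" for r q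
  proof (induction q rule: int_induct[where k = 0])
    case (step1 q)
    then show ?case using assms[of "r + int n * q"] by (simp add: algebra_simps)
  next
    case (step2 q)
    then show ?case using assms[of "r + int n * (q - 1)"] by (simp add: algebra_simps)
  qed simp
  from this[of "j mod int n" "j div int n"] show ?thesis by simp
qed

text \<open>The whirl evaluates \<open>\<epsilon>\<close> at residues modulo \<open>n\<close> only, which is harmless by periodicity.\<close>

lemma whirl_times_eq_asw_step:
  assumes X: "triangular_tp X" "shift_invariant n X" and low: "\<And>i j. j < i \<Longrightarrow> X i j = 0"
  shows "whirl n (\<lambda>j. - epsilon X j) \<odot> X = asw_step X"
proof (intro ext)
  fix i j
  have eps: "epsilon X (i mod int n) = epsilon X i"
    by (rule periodic_mod) (rule shift_invariant_epsilon[OF X])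
  show "(whirl n (\<lambda>j. - epsilon X j) \<odot> X) i j = asw_step X i j"
  proof (cases "i < j")
    case True
    have "(\<Sum>t\<in>{i..j}. whirl n (\<lambda>j. - epsilon X j) i t * X t j)
        = (\<Sum>t\<in>{i, i + 1}. whirl n (\<lambda>j. - epsilon X j) i t * X t j)"
      by (rule sum.mono_neutral_right) (use True in \<open>auto simp: whirl_def\<close>)
    then show ?thesis by (simp add: zmat_mult_def whirl_def asw_step_def eps)
  next
    case False
    then show ?thesis
      using low by (cases "i = j") (simp_all add: zmat_mult_def whirl_def asw_step_def)
  qed
qed

lemma RC_asw_tails:
  assumes n: "n \<ge> 1" and X: "X \<in> RC n"
  shows "asw_tails (asw_param n X) (asw_mat n X)" and "asw_param n X (Suc m) (j mod int n) = asw_param n X (Suc m) j"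
proof -
  obtain b where b: "\<forall>m\<ge>1. \<forall>j\<in>{0..<int n}. b m j > 0" and lim: "has_curl_prod n b X"
    using X by (auto simp: RC_def)
  let ?\<beta> = "\<lambda>m t. b m (t mod int n)"
  have \<beta>: "?\<beta> (Suc m) j > 0" for m j using b n by simp
  have prod_lim: "(\<lambda>m. gprod ?\<beta> m i j) \<longlonglongrightarrow> X i j" for i j
    using lim by (simp add: has_curl_prod_def curl_prod_eq_gprod)
  obtain T where T: "curl_tails ?\<beta> T" "T 0 = X"
    using curl_tails_of_gprod_tendsto[OF \<beta> prod_lim] by blast
  let ?a = "\<lambda>m. epsilon (asw_iter X (m - 1))"
  interpret A: curl_tails ?a "asw_iter X" by (rule curl_tails_asw[OF T])
  have inv: "shift_invariant n (asw_iter X m)" for m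
  proof (induction m)
    case 0
    have gp: "gprod ?\<beta> m (i + int n) (j + int n) = gprod ?\<beta> m i j" for m i j
      using shift_invariant_gprod[of ?\<beta> n] by (simp add: shift_invariant_def)
    have "X (i + int n) (j + int n) = X i j" for i j
      using prod_lim[of "i + int n" "j + int n"] prod_lim[of i j] unfolding gp by (rule LIMSEQ_unique)
    then show ?case by (simp add: shift_invariant_def)
  next
    case (Suc m)
    then show ?case by (simp add: shift_invariant_asw_step A.tp)
  qed
  have iter: "asw_mat n X m = asw_iter X m" for m
  proof (induction m)
    case (Suc m)
    then show ?case by (simp add: whirl_times_eq_asw_step[OF A.tp inv A.lower])
  qed simp
  then have mat: "asw_mat n X = asw_iter X" by blast
  then have param: "asw_param n X = ?a" by (intro ext) (simp only: asw_param_def)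
  show "asw_tails (asw_param n X) (asw_mat n X)"
    unfolding param mat by unfold_locales simp
  show "asw_param n X (Suc m) (j mod int n) = asw_param n X (Suc m) j"
    unfolding param by (rule periodic_mod) (rule shift_invariant_epsilon[OF A.tp inv])
qed

text \<open>Finitely many tableaux of a finite shape use finitely many entries, so the sums over bounded entries
  are cofinal among all finite partial sums.\<close>

lemma infsum_tableaux_eq_limit:
  fixes w :: "(nat \<times> int \<Rightarrow> nat) \<Rightarrow> real"
  assumes S: "finite S" and w: "\<And>U. U \<in> ssyt S {1..} \<Longrightarrow> w U \<ge> 0"
    and lim: "(\<lambda>m. \<Sum>U\<in>ssyt S {1..m}. w U) \<longlonglongrightarrow> L"
  shows "(\<Sum>\<^sub>\<infinity>U\<in>ssyt S {1..}. w U) = L"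
proof -
  have sub: "ssyt S {1..m} \<subseteq> ssyt S {1..}" for m by (rule ssyt_mono) auto
  have fin: "finite (ssyt S {1..m})" for m :: nat by (rule finite_ssyt[OF S]) simp
  have "incseq (\<lambda>m. \<Sum>U\<in>ssyt S {1..m}. w U)"
  proof (rule incseq_SucI)
    show "(\<Sum>U\<in>ssyt S {1..m}. w U) \<le> (\<Sum>U\<in>ssyt S {1..Suc m}. w U)" for m
      by (rule sum_mono2[OF fin ssyt_mono]) (use sub w in auto)
  qed
  then have partial: "(\<Sum>U\<in>ssyt S {1..m}. w U) \<le> L" for m using lim by (rule incseq_le)
  have bound: "(\<Sum>U\<in>F. w U) \<le> L" if F: "finite F" "F \<subseteq> ssyt S {1..}" for F
  proof -
    have "finite ((\<lambda>(U, s). U s) ` (F \<times> S))" using F S by simp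
    then obtain m where m: "\<And>U s. U \<in> F \<Longrightarrow> s \<in> S \<Longrightarrow> U s \<le> m"
      unfolding finite_nat_set_iff_bounded_le by fastforce
    then have "F \<subseteq> ssyt S {1..m}" using F(2) by (fastforce simp: ssyt_def PiE_iff)
    then have "(\<Sum>U\<in>F. w U) \<le> (\<Sum>U\<in>ssyt S {1..m}. w U)"
      by (intro sum_mono2[OF fin]) (use sub w in auto)
    then show ?thesis using partial[of m] by simp
  qed
  have summable: "w summable_on ssyt S {1..}"
    by (rule nonneg_bdd_above_summable_on[OF w]) (use bound in \<open>auto intro!: bdd_aboveI[of _ L]\<close>)
  have "infsum w (ssyt S {1..}) \<le> L"
    by (rule infsum_le_finite_sums[OF summable bound])
  moreover have "L \<le> infsum w (ssyt S {1..})"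
    by (rule LIMSEQ_le_const2[OF lim])
      (use finite_sum_le_infsum[OF summable fin sub] w in blast)
  ultimately show ?thesis by simp
qed

lemma nth_elem_strict_mono:
  assumes "finite I" "card I = k"
  shows "strict_mono_on {..<k} (\<lambda>p. nth_elem I (Suc p))"
proof (rule strict_mono_onI)
  fix p q assume "p \<in> {..<k}" "q \<in> {..<k}" "p < q"
  then show "nth_elem I (Suc p) < nth_elem I (Suc q)"
    using sorted_wrt_nth_less[OF strict_sorted_list_of_set[of I], of p q] assms
    by (simp add: nth_elem_def)
qed

lemma nth_elem_int_block:
  assumes "p < k"
  shows "nth_elem (int_block k h) (Suc p) = h + 1 + int p"
proof -
  have "sorted_list_of_set (set [h + 1..h + int k]) = [h + 1..h + int k]"
    by (rule sorted_list_of_set.idem_if_sorted_distinct) (simp_all add: sorted_upto)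
  then show ?thesis using assms by (simp add: nth_elem_def int_block_def nth_upto)
qed

lemma det_shape_cong:
  assumes "\<And>p. p < k \<Longrightarrow> f p = f' p" "\<And>p. p < k \<Longrightarrow> g p = g' p"
  shows "det_shape k f g = det_shape k f' g'"
  unfolding det_shape_def skew_shape_def using assms by auto

lemma lambda_shape_int_block:
  assumes "card I = k"
  shows "lambda_shape I (int_block k h) = det_shape k (\<lambda>p. nth_elem I (Suc p)) (\<lambda>q. h + 1 + int q)"
proof -
  have "card (int_block k h) = k" by (simp add: int_block_def)
  moreover have "Suc k - r = Suc (k - r)" if "r \<le> k" for r using that by simp
  ultimately show ?thesis
    using assms nth_elem_int_block[of "k - r" k h for r]
    unfolding lambda_shape_def det_shape_def skew_shape_def shape_seq_def by auto
qed

lemma minor_int_block: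
  assumes "card I = k"
  shows "minor X I (int_block k h) = pminor k X (\<lambda>p. nth_elem I (Suc p)) (\<lambda>q. h + 1 + int q)"
proof -
  have "minor X I (int_block k h)
      = pminor k X (\<lambda>p. nth_elem I (Suc p)) (\<lambda>q. nth_elem (int_block k h) (Suc q))"
    using assms by (simp add: minor_def pminor_def vdet_def)
  then show ?thesis using nth_elem_int_block by (simp cong: pminor_cong)
qed

lemma (in curl_tails) loop_schur_eq_pminor:
  assumes per: "\<And>m j. b (Suc m) (j mod int n) = b (Suc m) j"
    and fg: "strict_mono_on {..<k} f" "strict_mono_on {..<k} g" "\<And>p. p < k \<Longrightarrow> f p \<le> g p"
  shows "loop_schur n b (det_shape k f g) = pminor k (T 0) f g"
    and "loop_schur_upto n m b (det_shape k f g) = pminor k (gprod b m) f g"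
proof -
  let ?S = "det_shape k f g"
  have weight: "tableau_weight n b ?S U = content_weight b ?S U" if "U \<in> ssyt ?S {1..}" for U
    unfolding tableau_weight_def content_weight_def
  proof (rule prod.cong[OF refl])
    fix s assume "s \<in> ?S"
    then have "U s = Suc (U s - 1)" using that by (auto simp: ssyt_def PiE_iff)
    then show "b (U s) (residue n s) = b (U s) (snd s - int (fst s))"
      unfolding residue_def using per by metis
  qed
  have sub: "ssyt ?S {1..m} \<subseteq> ssyt ?S {1..}" for m by (rule ssyt_mono) auto
  have nn: "content_weight b ?S U \<ge> 0" if "U \<in> ssyt ?S {1..}" for U
    using less_imp_le[OF pos] that by (rule content_weight_nonneg)
  have "(\<Sum>\<^sub>\<infinity>U\<in>ssyt ?S {1..}. content_weight b ?S U) = pminor k (T 0) f g"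
    by (rule infsum_tableaux_eq_limit[OF finite_det_shape nn pminor_tableaux_tendsto[OF fg]])
  then show "loop_schur n b ?S = pminor k (T 0) f g"
    unfolding loop_schur_def using infsum_cong[OF weight] by (rule trans[rotated])
  have "loop_schur_upto n m b ?S = (\<Sum>U\<in>ssyt ?S {1..m}. content_weight b ?S U)"
    unfolding loop_schur_upto_def using weight sub by (intro sum.cong) auto
  then show "loop_schur_upto n m b ?S = pminor k (gprod b m) f g"
    using pminor_gprod_eq_tableau_sum[OF fg] by simp
qed

theorem theorem10p1:
  fixes n k :: nat and i :: int and I :: "int set"
    and X :: zmat and a :: "nat \<Rightarrow> int \<Rightarrow> real" and \<nu> :: "(nat \<times> int) set"
  assumes "n \<ge> 1"
    and "X \<in> RC n"
    and "a = asw_param n X"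
    and "k \<ge> 1"
    and "finite I" and "card I = k" and "\<forall>x\<in>I. x > 0"
    and "\<forall>t\<in>{1..k}. nth_elem I t \<le> i + int t"
    and "\<nu> = skew_shape k (\<lambda>r. i + int k) (shape_seq I)"
  shows "((\<lambda>h::nat. loop_schur n a (lambda_shape I (int_block k (int h)))
                   / loop_schur n a (lambda_shape (int_block k i) (int_block k (int h))))
            \<longlonglongrightarrow> loop_schur_upto n k a \<nu>)
       \<and> ((\<lambda>h::nat. minor X I (int_block k (int h))
                   / minor X (int_block k i) (int_block k (int h)))
            \<longlonglongrightarrow> loop_schur_upto n k a \<nu>)"
proof -
  interpret asw_tails a "asw_mat n X" unfolding assms(3) by (rule RC_asw_tails(1)[OF assms(1,2)])
  have per: "a (Suc m) (j mod int n) = a (Suc m) j" for m j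
    unfolding assms(3) by (rule RC_asw_tails(2)[OF assms(1,2)])
  define f where "f p = nth_elem I (Suc p)" for p
  define block where "block h q = h + 1 + int q" for h q
  have f_mono: "strict_mono_on {..<k} f"
    unfolding f_def by (rule nth_elem_strict_mono[OF assms(5,6)])
  have block_mono: "strict_mono_on {..<k} (block h)" for h
    by (auto simp: block_def strict_mono_on_def)
  have f_le: "f p \<le> i + 1 + int p" if "p < k" for p
    using assms(8)[rule_format, of "Suc p"] that by (simp add: f_def)
  have card_block: "card (int_block k i) = k" by (simp add: int_block_def)
  have blk: "pminor k Y (\<lambda>p. nth_elem (int_block k i) (Suc p)) g = pminor k Y (block i) g"
    "det_shape k (\<lambda>p. nth_elem (int_block k i) (Suc p)) g = det_shape k (block i) g" for Y g
    by (rule pminor_cong det_shape_cong; simp add: nth_elem_int_block block_def)+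
  have minors: "minor X I (int_block k h) = pminor k X f (block h)"
    "minor X (int_block k i) (int_block k h) = pminor k X (block i) (block h)" for h
    using minor_int_block[OF assms(6)] minor_int_block[OF card_block] blk(1)
    by (simp_all add: f_def[abs_def] block_def[abs_def])
  have shapes: "lambda_shape I (int_block k h) = det_shape k f (block h)"
    "lambda_shape (int_block k i) (int_block k h) = det_shape k (block i) (block h)" for h
    using lambda_shape_int_block[OF assms(6)] lambda_shape_int_block[OF card_block] blk(2)
    by (simp_all add: f_def[abs_def] block_def[abs_def])
  have "\<nu> = det_shape k f (block i)"
  proof -
    have "Suc k - r = Suc (k - r)" if "r \<le> k" for r using that by simp
    then show ?thesis
      unfolding assms(9) det_shape_def skew_shape_def shape_seq_def assms(6) f_def block_def by auto
  qed
  then have limit: "loop_schur_upto n k a \<nu> = pminor k (gprod a k) f (block i)"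
    using loop_schur_eq_pminor(2)[OF per f_mono block_mono, of i k] f_le by (simp add: block_def)
  have minor_lim: "(\<lambda>h. minor X I (int_block k (int h)) / minor X (int_block k i) (int_block k (int h)))
      \<longlonglongrightarrow> loop_schur_upto n k a \<nu>"
    using minor_ratio_tendsto[OF assms(4) f_mono f_le]
    unfolding minors limit by (simp add: block_def[abs_def])
  have "\<forall>\<^sub>F h in sequentially.
      minor X I (int_block k (int h)) / minor X (int_block k i) (int_block k (int h))
      = loop_schur n a (lambda_shape I (int_block k (int h)))
        / loop_schur n a (lambda_shape (int_block k i) (int_block k (int h)))"
  proof (rule eventually_sequentiallyI[of "nat i"])
    fix h assume "nat i \<le> h"
    then have "f p \<le> block (int h) p" "block i p \<le> block (int h) p" if "p < k" for p
      using f_le[OF that] by (auto simp: block_def)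
    then show "minor X I (int_block k (int h)) / minor X (int_block k i) (int_block k (int h))
      = loop_schur n a (lambda_shape I (int_block k (int h)))
        / loop_schur n a (lambda_shape (int_block k i) (int_block k (int h)))"
      unfolding minors shapes using loop_schur_eq_pminor(1)[OF per _ block_mono] f_mono block_mono
      by simp
  qed
  then have "(\<lambda>h. loop_schur n a (lambda_shape I (int_block k (int h)))
        / loop_schur n a (lambda_shape (int_block k i) (int_block k (int h))))
      \<longlonglongrightarrow> loop_schur_upto n k a \<nu>"
    by (rule Lim_transform_eventually[OF minor_lim])
  then show ?thesis using minor_lim by blast
qed

end
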